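(* Let $N\ge2$ be an integer. Then \[ \mathbb{II}_{\mathcal N}^{{\rm SU}(N)_{-N-1}}(x;q)=\frac{1}{(q;q)_\infty}\sum_{n\in\mathbb{Z}}(-1)^{Nn}q^{Nn^2/2}x^{Nn}, \] \[ \langle W_1\rangle^{{\rm SU}(N)_{-N-1}}(x;q)=\frac{(-xq^{1/2})^{N-1}}{(q;q)_\infty}\sum_{n\in\mathbb{Z}}(-1)^{Nn}q^{\frac{Nn^2}{2}+(N-1)n}x^{Nn}. \]
   Context: Let $|q|<1$, $x$ a nonzero parameter, $(a;q)_\infty=\prod_{k\ge0}(1-aq^k)$ and $(a^{\pm};q)_\infty:=(a;q)_\infty(a^{-1};q)_\infty$. Let $s_1,\dots,s_{N-1}$ be variables and $s_N:=(s_1\cdots s_{N-1})^{-1}$. For $m\in\mathbb{Z}$ define \[ \langle W_m\rangle^{{\rm SU}(N)_{-N-1}}(x;q):=\frac{(q;q)_\infty^{N-1}}{N!}\oint\prod_{i=1}^{N-1}\frac{ds_i}{2\pi i s_i}\prod_{\substack{i,j=1\\ i\ne j}}^N(s_is_j^{-1};q)_\infty\prod_{i=1}^N(q^{1/2}s_ix;q)_\infty(q^{1/2}s_i^{-1}x^{-1};q)_\infty\sum_{i=1}^N s_i^m, \] where the integral denotes the constant term in $s_1,\dots,s_{N-1}$ of the integrand expanded as a formal Laurent series in the $s_i$ (equivalently the contour integral over unit circles), and $\mathbb{II}_{\mathcal N}^{{\rm SU}(N)_{-N-1}}(x;q):=\frac1N\langle W_0\rangle^{{\rm SU}(N)_{-N-1}}(x;q)$.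 *)

theory Defs
  imports "HOL-Analysis.Analysis"
begin

definition qpoch :: "complex \<Rightarrow> complex \<Rightarrow> complex" where
  "qpoch a q = (\<Prod>k. 1 - a * q ^ k)"

text \<open>Torus coordinates: s_i = exp(2 pi i theta_i) for i < N-1, and
  s_{N-1} (the paper's s_N) = (s_0 ... s_{N-2})^{-1}.  Indices are 0-based.\<close>
definition torus_s :: "nat \<Rightarrow> (nat \<Rightarrow> real) \<Rightarrow> nat \<Rightarrow> complex" where
  "torus_s N \<theta> i =
     (if i < N - 1 then exp (2 * pi * \<i> * complex_of_real (\<theta> i))
      else inverse (\<Prod>j<N - 1. exp (2 * pi * \<i> * complex_of_real (\<theta> j))))"

text \<open>The integrand; r plays the role of q^{1/2}.\<close>
definition su_integrand ::
  "int \<Rightarrow> nat \<Rightarrow> complex \<Rightarrow> complex \<Rightarrow> complex \<Rightarrow> (nat \<Rightarrow> real) \<Rightarrow> complex" where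
  "su_integrand m N q r x \<theta> =
     (let s = torus_s N \<theta> in
       (\<Prod>i<N. \<Prod>j<N. if i \<noteq> j then qpoch (s i / s j) q else 1)
       * (\<Prod>i<N. qpoch (r * s i * x) q * qpoch (r * inverse (s i) * inverse x) q)
       * (\<Sum>i<N. s i powi m))"

text \<open>The Wilson line index <W_m>: the contour integral over unit circles of
  prod ds_i/(2 pi i s_i) equals the average over the torus, i.e. the integral over
  theta in [0,1]^(N-1) w.r.t. Lebesgue measure.\<close>
definition Wloop :: "int \<Rightarrow> nat \<Rightarrow> complex \<Rightarrow> complex \<Rightarrow> complex \<Rightarrow> complex" where
  "Wloop m N q r x =
     qpoch q q ^ (N - 1) / of_nat (fact N) *
     (LINT \<theta> | PiM {..<N - 1} (\<lambda>_. restrict_space lborel {0..1::real}).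
        su_integrand m N q r x \<theta>)"

definition IIN :: "nat \<Rightarrow> complex \<Rightarrow> complex \<Rightarrow> complex \<Rightarrow> complex" where
  "IIN N q r x = Wloop 0 N q r x / of_nat N"

end

theory Submission
  imports Defs "HOL-Probability.Infinite_Product_Measure" "Jordan_Normal_Form.Determinant"
begin

text \<open>
  Add a variable \<open>u_N = z\<close> to the \<open>N\<close> torus variables \<open>u_i = y s_i\<close>, where \<open>y = r x z\<close>. The
  product of the factors \<open>(s_i/s_j; q)\<close> and of the fundamental matter factors is then, up to a second
  Vandermonde product in the \<open>1/s_i\<close>, the affine \<open>A_N\<close> Weyl denominator in \<open>u_0, ..., u_N\<close>. In each
  variable separately this denominator lies in an \<open>(N+1)\<close>-dimensional space of theta functions; its
  values at the roots of unity of order \<open>N+1\<close> identify it with the determinant of the basis theta series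
  \<open>\<Theta>_j (u_i)\<close> (Macdonald's identity of type \<open>A\<close>). Integration over the torus extracts products of
  coefficients of these series. They are alternating and quasi-periodic in the exponents, so a
  single family of exponents, indexed by two integers, survives; the resulting double sum
  factorizes into a Jacobi triple product and the series of the statement.
\<close>

section \<open>Alternating sums and the Vandermonde determinant\<close>

text \<open>The difficulty of a denominator identity is its constant, which matching zeros leaves
  undetermined. At an n-th root of unity w every basis series satisfies Theta_j(w) = w^j Theta_j(1),
  so the determinant there is an explicit multiple of a Vandermonde product, and the infinite
  products collapse too. As n such values determine an element of the n-dimensional space, constant
  and identity come out together. The variable z is not integrated. The scaling y = r x z turns z -
  u_i into z (1 - r x s_i), the first matter factor, and q z / u_i into r / (x s_i). The s_i
  multiply to 1, so all N+1 variables multiply to y^N z; requiring the value (-1)^N makes the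
  leading theta of the kernel constant and fixes z up to a root of unity, on which the result does
  not depend. The product over i and j contains Vandermonde products in s_i and in 1/s_i, and the
  determinant absorbs only the first. The N! terms of the second cancel the 1/N! of the
  definition.\<close>

definition leibniz :: "nat \<Rightarrow> (nat \<Rightarrow> nat \<Rightarrow> 'a) \<Rightarrow> 'a::comm_ring_1" where
  "leibniz n f = (\<Sum>p | p permutes {..<n}. of_int (sign p) * (\<Prod>i<n. f (p i) i))"

lemma leibniz_cong:
  assumes "\<And>i j. i < n \<Longrightarrow> j < n \<Longrightarrow> f j i = g j i"
  shows "leibniz n f = leibniz n g"
  unfolding leibniz_def
proof (intro sum.cong refl arg_cong2[where f = "(*)"] prod.cong)
  fix p i assume "p \<in> {p. p permutes {..<n}}" "i \<in> {..<n}"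
  then show "f (p i) i = g (p i) i"
    using assms[of i "p i"] permutes_in_image[of p "{..<n}" i] by simp
qed

lemma leibniz_permute:
  assumes \<pi>: "\<pi> permutes {..<n}"
  shows "leibniz n (\<lambda>j i. f j (\<pi> i)) = of_int (sign \<pi>) * leibniz n f"
proof -
  have fin: "finite {..<n}" by simp
  have "leibniz n (\<lambda>j i. f j (\<pi> i)) =
      (\<Sum>p | p permutes {..<n}. of_int (sign (p \<circ> \<pi>)) * (\<Prod>i<n. f ((p \<circ> \<pi>) i) (\<pi> i)))"
    unfolding leibniz_def
    by (rule sum_permutations_compose_right[OF \<pi>])
  also have "\<dots> = (\<Sum>p | p permutes {..<n}. of_int (sign \<pi>) * (of_int (sign p) * (\<Prod>i<n. f (p i) i)))"
  proof (rule sum.cong[OF refl])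
    fix p assume "p \<in> {p. p permutes {..<n}}"
    then have p: "p permutes {..<n}" by simp
    have "sign (p \<circ> \<pi>) = sign p * sign \<pi>"
      using p \<pi> fin by (intro sign_compose permutes_imp_permutation)
    moreover have "(\<Prod>i<n. f ((p \<circ> \<pi>) i) (\<pi> i)) = (\<Prod>i<n. f (p i) i)"
      using prod.permute[OF \<pi>, of "\<lambda>i. f (p i) i"] by (simp add: o_def)
    ultimately show "of_int (sign (p \<circ> \<pi>)) * (\<Prod>i<n. f ((p \<circ> \<pi>) i) (\<pi> i))
        = of_int (sign \<pi>) * (of_int (sign p) * (\<Prod>i<n. f (p i) i))"
      by (simp add: mult_ac)
  qed
  also have "\<dots> = of_int (sign \<pi>) * leibniz n f"
    by (simp add: leibniz_def sum_distrib_left)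
  finally show ?thesis .
qed

text \<open>Swapping the two equal columns leaves the sum unchanged and also negates it.\<close>

lemma leibniz_eq_0:
  fixes f :: "nat \<Rightarrow> nat \<Rightarrow> complex"
  assumes "a < n" "b < n" "a \<noteq> b" "\<And>j. j < n \<Longrightarrow> f j a = f j b"
  shows "leibniz n f = 0"
proof -
  have "leibniz n f = leibniz n (\<lambda>j i. f j (Transposition.transpose a b i))"
    by (intro leibniz_cong) (auto simp: Transposition.transpose_def assms)
  also have "\<dots> = - leibniz n f"
    using assms leibniz_permute[of "Transposition.transpose a b" n f]
    by (simp add: permutes_swap_id sign_swap_id)
  finally show ?thesis by simp
qed

lemma leibniz_scale:
  "leibniz n (\<lambda>j i. c i * f j i) = (\<Prod>i<n. c i) * leibniz n f"
  by (simp add: leibniz_def prod.distrib sum_distrib_left mult_ac)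

lemma leibniz_scale_row:
  "leibniz n (\<lambda>j i. c j * f j i) = (\<Prod>j<n. c j) * leibniz n f"
proof -
  have "(\<Prod>i<n. c (p i)) = (\<Prod>j<n. c j)" if "p permutes {..<n}" for p
    using prod.permute[OF that, of c] by (simp add: o_def)
  then show ?thesis
    unfolding leibniz_def sum_distrib_left
    by (intro sum.cong) (simp_all add: prod.distrib mult_ac)
qed

text \<open>The bare permutation sum is the form that is later integrated and summed term by term;
  the matrix form serves to borrow column operations, Laplace expansion and the determinant of the
  identity matrix.\<close>

lemma leibniz_det: "leibniz n f = Determinant.det (mat n n (\<lambda>(i, j). f j i))"
proof -
  have "(\<Prod>i<n. f (p i) i) = (\<Prod>i<n. mat n n (\<lambda>(i, j). f j i) $$ (i, p i))"
    if "p permutes {..<n}" for p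
    using permutes_in_image[OF that] by (intro prod.cong) auto
  moreover have "signof p = (of_int (sign p) :: 'a)" for p :: "nat \<Rightarrow> nat"
    by (auto simp: sign_def)
  ultimately show ?thesis
    by (subst det_def'[of _ n])
       (auto simp: leibniz_def atLeast0LessThan intro!: sum.cong)
qed

lemma vandermonde_leibniz:
  fixes u :: "nat \<Rightarrow> 'a::idom"
  shows "leibniz n (\<lambda>j i. u i ^ j) = (\<Prod>j<n. \<Prod>i<j. u j - u i)"
proof (induction n)
  case 0
  show ?case by (simp add: leibniz_def)
next
  case (Suc n)
  define A where "A = mat (Suc n) (Suc n) (\<lambda>(i, j). u i ^ j)"
  define B where "B = mat (Suc n) (Suc n) (\<lambda>(i, j). if i = j then 1 else if j = Suc i then - u n else 0)"
  define C where "C = mat (Suc n) (Suc n) (\<lambda>(i, j). if j = 0 then 1 else u i ^ j - u n * u i ^ (j - 1))"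
  have [simp]: "A \<in> carrier_mat (Suc n) (Suc n)" "B \<in> carrier_mat (Suc n) (Suc n)"
     "C \<in> carrier_mat (Suc n) (Suc n)"
    by (auto simp: A_def B_def C_def)
  have "Determinant.det B = prod_list (diag_mat B)"
    by (rule det_upper_triangular[of _ "Suc n"]) (auto simp: B_def)
  also have "\<dots> = (\<Prod>i = 0..<Suc n. 1)"
    unfolding prod_list_diag_prod by (rule prod.cong) (auto simp: B_def)
  finally have B: "Determinant.det B = 1" by simp
  \<comment> \<open>Subtracting \<open>u n\<close> times each column from the next one clears the last row.\<close>
  have AB: "A * B = C"
  proof (rule eq_matI)
    fix i j assume "i < dim_row C" "j < dim_col C"
    then have ij: "i < Suc n" "j < Suc n" by (auto simp: C_def)
    have "(A * B) $$ (i, j) = (\<Sum>k = 0..<Suc n. u i ^ k * (if k = j then 1 else if j = Suc k then - u n else 0))"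
      using ij by (auto simp: A_def B_def scalar_prod_def simp del: sum.atLeast0_lessThan_Suc intro!: sum.cong)
    also have "\<dots> = (\<Sum>k = 0..<Suc n. (if k = j then u i ^ k else 0) +
        (if k = j - 1 then (if j = 0 then 0 else - u n * u i ^ k) else 0))"
      by (intro sum.cong) auto
    also have "\<dots> = C $$ (i, j)"
      using ij by (cases j) (simp_all add: sum.distrib C_def del: sum.atLeast0_lessThan_Suc)
    finally show "(A * B) $$ (i, j) = C $$ (i, j)" .
  qed (auto simp: A_def B_def C_def)
  have "Determinant.det A = Determinant.det C"
    using det_mult[of A "Suc n" B] B AB by simp
  also have "\<dots> = (\<Sum>j<Suc n. C $$ (n, j) * cofactor C n j)"
    by (rule laplace_expansion_row) auto
  also have "\<dots> = (\<Sum>j<Suc n. if j = 0 then cofactor C n j else 0)"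
    by (intro sum.cong) (auto simp: C_def power_eq_if)
  also have "\<dots> = (-1) ^ n * Determinant.det (mat_delete C n 0)"
    by (simp add: cofactor_def del: sum.lessThan_Suc)
  also have "mat_delete C n 0 = mat n n (\<lambda>(i, j). (u i - u n) * u i ^ j)"
    by (rule eq_matI) (auto simp: mat_delete_def C_def algebra_simps)
  also have "Determinant.det \<dots> = leibniz n (\<lambda>j i. (u i - u n) * u i ^ j)"
    by (simp add: leibniz_det)
  also have "\<dots> = (\<Prod>i<n. u i - u n) * (\<Prod>j<n. \<Prod>i<j. u j - u i)"
    by (simp add: leibniz_scale Suc)
  also have "(-1) ^ n * \<dots> = (\<Prod>i<n. u n - u i) * (\<Prod>j<n. \<Prod>i<j. u j - u i)"
  proof -
    have "(-1) ^ n * (\<Prod>i<n. u i - u n) = (\<Prod>i<n. (-1) * (u i - u n))"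
      by (simp only: prod.distrib prod_constant card_lessThan)
    then show ?thesis by (simp add: mult.assoc[symmetric])
  qed
  finally show ?case
    by (simp add: leibniz_det A_def mult.commute)
qed

text \<open>A cycle of length N+1. Raising N+1 consecutive exponents by one amounts to applying it
  and then adding N+1 to the last entry; \<open>alt_coeff_consecutive\<close> rests on this.\<close>

definition cycle_up :: "nat \<Rightarrow> nat \<Rightarrow> nat" where
  "cycle_up N i = (if i < N then Suc i else if i = N then 0 else i)"

lemma cycle_up_permutes: "cycle_up N permutes {..<Suc N}"
  and sign_cycle_up: "sign (cycle_up N) = (-1) ^ N"
proof -
  have "cycle_up N permutes {..<Suc N} \<and> sign (cycle_up N) = (-1) ^ N"
  proof (induction N)
    case 0
    have "cycle_up 0 = id" by (auto simp: cycle_up_def)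
    then show ?case by (metis permutes_id sign_id power_0)
  next
    case (Suc N)
    have eq: "cycle_up (Suc N) = cycle_up N \<circ> Transposition.transpose N (Suc N)"
      by (auto simp: cycle_up_def Transposition.transpose_def fun_eq_iff)
    have p: "cycle_up N permutes {..<Suc (Suc N)}"
      using Suc by (auto intro: permutes_subset)
    have t: "Transposition.transpose N (Suc N) permutes {..<Suc (Suc N)}"
      by (rule permutes_swap_id) auto
    have "sign (cycle_up (Suc N)) = sign (cycle_up N) * sign (Transposition.transpose N (Suc N))"
      unfolding eq using p t by (intro sign_compose permutes_imp_permutation) auto
    moreover have "cycle_up (Suc N) permutes {..<Suc (Suc N)}"
      unfolding eq by (rule permutes_compose[OF t p])
    ultimately show ?case
      using Suc by (simp add: sign_swap_id)
  qed
  then show "cycle_up N permutes {..<Suc N}" "sign (cycle_up N) = (-1) ^ N" by auto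
qed

section \<open>q-Pochhammer symbols\<close>

lemma qpoch_convergent:
  assumes "norm q < 1"
  shows "convergent_prod (\<lambda>k. 1 - a * q ^ k :: complex)"
proof (intro abs_convergent_prod_imp_convergent_prod summable_imp_abs_convergent_prod)
  have "summable (\<lambda>k. norm a * norm q ^ k)"
    using assms by (intro summable_mult summable_geometric) simp
  then show "summable (\<lambda>k. norm (1 - a * q ^ k - 1))"
    by (simp add: norm_mult norm_power)
qed

lemma qpoch_LIMSEQ:
  assumes "norm q < 1"
  shows "(\<lambda>M. \<Prod>k<M. 1 - a * q ^ k) \<longlonglongrightarrow> qpoch a q"
proof -
  have "(\<lambda>M. \<Prod>k\<le>M. 1 - a * q ^ k) \<longlonglongrightarrow> qpoch a q"
    unfolding qpoch_def by (rule convergent_prod_LIMSEQ[OF qpoch_convergent[OF assms]])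
  then show ?thesis
    by (subst filterlim_sequentially_Suc[symmetric]) (simp only: lessThan_Suc_atMost)
qed

lemma qpoch_rec:
  assumes "norm q < 1"
  shows "qpoch a q = (1 - a) * qpoch (a * q) q"
proof (rule LIMSEQ_unique)
  show "(\<lambda>M. \<Prod>k<Suc M. 1 - a * q ^ k) \<longlonglongrightarrow> qpoch a q"
    using qpoch_LIMSEQ[OF assms] by (rule LIMSEQ_Suc)
  have "(\<lambda>M. (1 - a) * (\<Prod>k<M. 1 - (a * q) * q ^ k)) \<longlonglongrightarrow> (1 - a) * qpoch (a * q) q"
    using assms by (intro tendsto_mult tendsto_const qpoch_LIMSEQ)
  then show "(\<lambda>M. \<Prod>k<Suc M. 1 - a * q ^ k) \<longlonglongrightarrow> (1 - a) * qpoch (a * q) q"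
    by (simp add: prod.lessThan_Suc_shift mult_ac del: prod.lessThan_Suc)
qed

lemma qpoch_nonzero:
  assumes "norm q < 1" "norm a < 1"
  shows "qpoch a q \<noteq> 0"
  unfolding qpoch_def
proof (rule prodinf_nonzero[OF qpoch_convergent[OF assms(1)]])
  fix k
  have "norm (a * q ^ k) \<le> norm a * 1"
    unfolding norm_mult norm_power using assms
    by (intro mult_left_mono power_le_one) auto
  then show "1 - a * q ^ k \<noteq> 0"
    using assms(2) by auto
qed

text \<open>The factors are sorted by the residue of their exponent mod \<open>n\<close>. On partial
  products this cuts \<open>M * n\<close> factors into \<open>M\<close> blocks of length
  \<open>n\<close>, and the limit is taken along that subsequence.\<close>

lemma prod_qpoch_powers:
  assumes "norm q < 1" "n > 0"
  shows "(\<Prod>j<n. qpoch (a * q ^ j) (q ^ n)) = qpoch a q"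
proof (rule LIMSEQ_unique)
  have "norm (q ^ n) < 1"
    using assms by (simp add: norm_power power_less_one_iff)
  then show "(\<lambda>M. \<Prod>j<n. \<Prod>k<M. 1 - a * q ^ j * (q ^ n) ^ k) \<longlonglongrightarrow> (\<Prod>j<n. qpoch (a * q ^ j) (q ^ n))"
    by (intro tendsto_prod qpoch_LIMSEQ)
  have eq: "(\<Prod>j<n. \<Prod>k<M. 1 - a * q ^ j * (q ^ n) ^ k) = (\<Prod>k<M * n. 1 - a * q ^ k)" for M
  proof -
    have "(\<Prod>k<M * n. 1 - a * q ^ k) = (\<Prod>k<M. \<Prod>i\<in>{k * n..<k * n + n}. 1 - a * q ^ i)"
      by (rule prod.nat_group[symmetric])
    also have "\<dots> = (\<Prod>k<M. \<Prod>j<n. 1 - a * q ^ j * (q ^ n) ^ k)"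
    proof (rule prod.cong[OF refl])
      fix k
      show "(\<Prod>i\<in>{k * n..<k * n + n}. 1 - a * q ^ i) = (\<Prod>j<n. 1 - a * q ^ j * (q ^ n) ^ k)"
        by (rule prod.reindex_bij_witness[of _ "\<lambda>j. k * n + j" "\<lambda>i. i - k * n"])
           (auto simp: mult.assoc mult.commute[of n] simp flip: power_mult power_add)
    qed
    finally show ?thesis
      by (subst prod.swap) simp
  qed
  have "(\<lambda>M. \<Prod>k<M * n. 1 - a * q ^ k) \<longlonglongrightarrow> qpoch a q"
    using qpoch_LIMSEQ[OF assms(1)]
    by (rule filterlim_compose) (use assms(2) in \<open>intro filterlim_subseq strict_monoI, simp\<close>)
  then show "(\<lambda>M. \<Prod>j<n. \<Prod>k<M. 1 - a * q ^ j * (q ^ n) ^ k) \<longlonglongrightarrow> qpoch a q"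
    by (simp only: eq)
qed

section \<open>Theta series\<close>

text \<open>The term is the \<open>k\<close>-th power of \<open>r ^ k * z\<close>, which tends to 0,
  so a geometric series eventually dominates.\<close>

lemma summable_gauss_nat:
  fixes r z :: real
  assumes "0 \<le> r" "r < 1" "0 \<le> z"
  shows "summable (\<lambda>k. r ^ (k * k) * z ^ k)"
proof (rule summable_comparison_test_ev)
  have "(\<lambda>k. r ^ k * z) \<longlonglongrightarrow> 0 * z"
    using assms by (intro tendsto_mult LIMSEQ_power_zero) auto
  then have "eventually (\<lambda>k. r ^ k * z < 1 / 2) sequentially"
    by (rule order_tendstoD) simp
  then show "eventually (\<lambda>k. norm (r ^ (k * k) * z ^ k) \<le> (1 / 2) ^ k) sequentially"
  proof eventually_elim
    case (elim k)
    have "norm (r ^ (k * k) * z ^ k) = (r ^ k * z) ^ k"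
      using assms by (simp add: power_mult power_mult_distrib)
    also have "\<dots> \<le> (1 / 2) ^ k"
      using elim assms by (intro power_mono) auto
    finally show ?case .
  qed
qed (simp add: summable_geometric)

lemma UNIV_int_halves: "(UNIV :: int set) = range int \<union> (\<lambda>k. - int k) ` {1..}"
proof -
  have "x \<in> range int \<union> (\<lambda>k. - int k) ` {1..}" for x :: int
  proof (cases "x \<ge> 0")
    case True
    then show ?thesis by (metis UnI1 nonneg_int_cases rangeI)
  next
    case False
    then have "x = - int (nat (- x))" "nat (- x) \<in> {1..}" by auto
    then show ?thesis by blast
  qed
  then show ?thesis by auto
qed

lemma summable_on_gauss_real:
  fixes r z :: real
  assumes "0 < r" "r < 1" "0 < z"
  shows "(\<lambda>k::int. r powi (k * k) * z powi k) summable_on UNIV"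
  unfolding UNIV_int_halves
proof (rule summable_on_Un_disjoint)
  have "(\<lambda>k. r ^ (k * k) * z ^ k) summable_on UNIV"
    using summable_gauss_nat[of r z] assms by (simp add: summable_on_UNIV_nonneg_real_iff)
  then show "(\<lambda>k::int. r powi (k * k) * z powi k) summable_on range int"
    by (subst summable_on_reindex)
       (simp_all add: o_def flip: of_nat_mult)
  have "(\<lambda>k. r ^ (k * k) * inverse z ^ k) summable_on UNIV"
    using summable_gauss_nat[of r "inverse z"] assms by (simp add: summable_on_UNIV_nonneg_real_iff)
  then have "(\<lambda>k. r ^ (k * k) * inverse z ^ k) summable_on {1..}"
    by (rule summable_on_subset_banach) auto
  then show "(\<lambda>k::int. r powi (k * k) * z powi k) summable_on (\<lambda>k. - int k) ` {1..}"
    by (subst summable_on_reindex)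
       (simp_all add: o_def inj_on_def power_int_minus power_inverse flip: of_nat_mult)
  show "range int \<inter> (\<lambda>k. - int k) ` {1..} = {}" by auto
qed

lemma summable_on_gauss:
  fixes r z :: complex
  assumes "r \<noteq> 0" "norm r < 1" "z \<noteq> 0"
  shows "(\<lambda>k::int. norm (r powi (k * k) * z powi k)) summable_on UNIV"
  using summable_on_gauss_real[of "norm r" "norm z"] assms
  by (simp add: norm_mult norm_power_int)

text \<open>With q = r^2 this is Jacobi's theta function without the factor (q;q). It is invariant
  under z -> 1/z and satisfies theta(q z) = - theta(z) / (r z), the source of the recurrences for
  Laurent coefficients.\<close>

definition theta :: "complex \<Rightarrow> complex \<Rightarrow> complex" where
  "theta r z = qpoch (r * z) (r\<^sup>2) * qpoch (r / z) (r\<^sup>2)"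

section \<open>The Jacobi triple product as a limit of its finite form\<close>

definition qfin :: "complex \<Rightarrow> nat \<Rightarrow> complex" where
  "qfin q m = (\<Prod>k<m. 1 - q ^ Suc k)"

text \<open>The reciprocal of (q;q)_m, extended by 0 to negative m. The recurrence
  \<open>inv_qfin_rec\<close> then holds at every integer, at m = -1 because of the factor 1 - q^0,
  so finite q-binomial sums can be written over all integers.\<close>

definition inv_qfin :: "complex \<Rightarrow> int \<Rightarrow> complex" where
  "inv_qfin q m = (if m < 0 then 0 else 1 / qfin q (nat m))"

lemma qfin_nonzero: "norm q < 1 \<Longrightarrow> qfin q m \<noteq> 0"
  unfolding qfin_def prod_zero_iff[OF finite_lessThan]
proof
  assume q: "norm q < 1" and "\<exists>k\<in>{..<m}. 1 - q ^ Suc k = 0"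
  then obtain k where "q ^ Suc k = 1" by auto
  then have "norm q ^ Suc k = 1" by (metis norm_one norm_power)
  with q show False using power_less_one_iff[of "norm q" "Suc k"] by simp
qed

lemma inv_qfin_rec:
  assumes "norm q < 1"
  shows "inv_qfin q m = (1 - q powi (m + 1)) * inv_qfin q (m + 1)"
proof (cases "m < 0")
  case True
  then show ?thesis by (cases "m = -1") (auto simp: inv_qfin_def)
next
  case False
  then have "nat (m + 1) = Suc (nat m)" by simp
  moreover have "q powi (m + 1) = q ^ Suc (nat m)"
    using False by (simp add: power_int_def nat_add_distrib)
  moreover have "1 - q ^ Suc (nat m) \<noteq> 0"
    using qfin_nonzero[OF assms, of "Suc (nat m)"] by (auto simp: qfin_def)
  ultimately show ?thesis
    using False by (simp add: inv_qfin_def qfin_def del: power_Suc)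
qed

text \<open>This is the symmetric q-binomial theorem, with the Gaussian binomial (2M choose M+k)
  divided by (q;q)_(2M) so that each coefficient converges by itself as M grows. Going from M to M+1
  multiplies the product by two linear factors, which combines the coefficients at k-1, k and
  k+1.\<close>

lemma finite_jacobi_triple:
  assumes r: "r \<noteq> 0" "norm r < 1" and z: "z \<noteq> 0"
  defines "q \<equiv> r\<^sup>2"
  shows "((\<lambda>k::int. (-1) powi k * r powi (k * k) * z powi k
            * inv_qfin q (int M - k) * inv_qfin q (int M + k)) has_sum
          ((\<Prod>j<M. (1 - r ^ (2 * j + 1) * z) * (1 - r ^ (2 * j + 1) / z)) / qfin q (2 * M))) UNIV"
proof (induction M)
  case 0
  have "((\<lambda>k::int. (-1) powi k * r powi (k * k) * z powi k
            * inv_qfin q (- k) * inv_qfin q k) has_sum (\<Sum>k\<in>{0}. (-1) powi k * r powi (k * k) * z powi k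
            * inv_qfin q (- k) * inv_qfin q k)) UNIV"
    by (rule has_sum_finite_neutralI[where B = "{0}"]) (auto simp: inv_qfin_def)
  then show ?case by (simp add: inv_qfin_def qfin_def)
next
  case (Suc M)
  define T where "T = (\<lambda>M k. (-1) powi k * r powi (k * k) * z powi k
            * inv_qfin q (int M - k) * inv_qfin q (int M + k))"
  define L where "L = (\<Prod>j<M. (1 - r ^ (2 * j + 1) * z) * (1 - r ^ (2 * j + 1) / z)) / qfin q (2 * M)"
  have q: "norm q < 1"
    using r by (simp add: q_def norm_power power_less_one_iff)
  have q0: "q \<noteq> 0" using r by (simp add: q_def)
  have qq: "q powi k = r powi (2 * k)" for k :: int
    by (simp add: q_def power_int_mult)
  define D where "D = (1 - q ^ Suc (2 * M)) * (1 - q ^ Suc (Suc (2 * M)))"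
  have D: "D \<noteq> 0"
    using qfin_nonzero[OF q, of "2 * M + 2"] by (simp add: qfin_def D_def)
  have IH: "(T M has_sum L) UNIV"
    using Suc unfolding T_def L_def .
  have shift: "((\<lambda>k. T M (k + a)) has_sum L) UNIV" for a :: int
    using has_sum_reindex_bij_betw[of "\<lambda>k::int. k + a" UNIV UNIV "T M" L] IH
    by (simp add: bij_plus_right)
  \<comment> \<open>The two new factors multiply to 1 + q^(2M+1) - r^(2M+1) (z + 1/z).
    Multiplication by z or 1/z moves the neighbouring terms to exponent k, and \<open>D\<close> is
    the quotient of \<open>qfin\<close> at 2M+2 and at 2M.\<close>
  have step: "T (Suc M) k = ((1 + q ^ (2 * M + 1)) * T M k
       + (- (r ^ (2 * M + 1))) * (z * T M (k + - 1) + T M (k + 1) / z)) / D" for k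
  proof -
    \<comment> \<open>In terms of \<open>A\<close> and \<open>B\<close>, whose product is q^(2M+2),
      all neighbouring terms become rational multiples of \<open>R * a * b\<close>, and the
      recurrence turns into an algebraic identity in \<open>A\<close>, \<open>B\<close> and
      \<open>q\<close>.\<close>
    define A where "A = q powi (int M + 1 - k)"
    define B where "B = q powi (int M + 1 + k)"
    define a where "a = inv_qfin q (int M + 1 - k)"
    define b where "b = inv_qfin q (int M + 1 + k)"
    have e1: "inv_qfin q (int M - k) = (1 - A) * a"
      using inv_qfin_rec[OF q, of "int M - k"] by (simp add: A_def a_def algebra_simps)
    have e2: "inv_qfin q (int M + k) = (1 - B) * b"
      using inv_qfin_rec[OF q, of "int M + k"] by (simp add: B_def b_def algebra_simps)
    have Aq: "q powi (int M - k) = A / q" "q powi (int M + k) = B / q"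
      using q0 by (simp_all add: A_def B_def power_int_add power_int_diff field_simps)
    have e3: "inv_qfin q (int M - (k + 1)) = (1 - A / q) * (1 - A) * a"
    proof -
      have "int M - (k + 1) + 1 = int M - k" by simp
      then show ?thesis
        using inv_qfin_rec[OF q, of "int M - (k + 1)"] by (simp only: e1 Aq mult.assoc)
    qed
    have e4: "inv_qfin q (int M + (k + - 1)) = (1 - B / q) * (1 - B) * b"
    proof -
      have "int M + (k + - 1) + 1 = int M + k" by simp
      then show ?thesis
        using inv_qfin_rec[OF q, of "int M + (k + - 1)"] by (simp only: e2 Aq mult.assoc)
    qed
    have AB: "A * B = q ^ Suc (Suc (2 * M))"
      by (simp add: A_def B_def q0 add.commute flip: power_int_add power_int_of_nat)
    have AB': "q ^ Suc (2 * M) = A * B / q"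
      using AB q0 by (simp add: field_simps)
    define R where "R = (-1) powi k * r powi (k * k) * z powi k"
    have R1: "r ^ (2 * M + 1) * ((-1) powi (k + - 1) * r powi ((k + - 1) * (k + - 1)) * z powi (k + - 1)) * z = - R * A"
    proof -
      have "r ^ (2 * M + 1) * r powi ((k + - 1) * (k + - 1)) = r powi (int (2 * M + 1) + (k + - 1) * (k + - 1))"
        by (simp only: power_int_add[OF disjI1[OF r(1)]] power_int_of_nat)
      also have "int (2 * M + 1) + (k + - 1) * (k + - 1) = k * k + 2 * (int M + 1 - k)"
        by (simp add: algebra_simps)
      also have "r powi \<dots> = r powi (k * k) * A"
        using r by (simp add: A_def qq power_int_add)
      finally have e: "r ^ (2 * M + 1) * r powi ((k + - 1) * (k + - 1)) = r powi (k * k) * A" .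
      have "(-1) powi (k + - 1) = - ((-1) powi k :: complex)"
        by (simp add: power_int_diff)
      note sg = this
      have zz: "z powi (k + - 1) * z = z powi k"
        using z by (simp add: power_int_diff)
      have "r ^ (2 * M + 1) * ((-1) powi (k + - 1) * r powi ((k + - 1) * (k + - 1)) * z powi (k + - 1)) * z
          = - ((-1) powi k * (r ^ (2 * M + 1) * r powi ((k + - 1) * (k + - 1))) * (z powi (k + - 1) * z))"
        by (simp only: sg mult_minus_left mult_minus_right mult.assoc mult.left_commute)
      also have "\<dots> = - R * A"
        unfolding e zz R_def by (simp add: mult_ac)
      finally show ?thesis .
    qed
    have R2: "r ^ (2 * M + 1) * ((-1) powi (k + 1) * r powi ((k + 1) * (k + 1)) * z powi (k + 1)) / z = - R * B"
    proof -
      have "r ^ (2 * M + 1) * r powi ((k + 1) * (k + 1)) = r powi (int (2 * M + 1) + (k + 1) * (k + 1))"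
        by (simp only: power_int_add[OF disjI1[OF r(1)]] power_int_of_nat)
      also have "int (2 * M + 1) + (k + 1) * (k + 1) = k * k + 2 * (int M + 1 + k)"
        by (simp add: algebra_simps)
      also have "r powi \<dots> = r powi (k * k) * B"
        using r by (simp add: B_def qq power_int_add)
      finally have e: "r ^ (2 * M + 1) * r powi ((k + 1) * (k + 1)) = r powi (k * k) * B" .
      have "(-1) powi (k + 1) = - ((-1) powi k :: complex)" "z powi (k + 1) = z * z powi k"
        using z by (simp_all add: power_int_add)
      then have "r ^ (2 * M + 1) * ((-1) powi (k + 1) * r powi ((k + 1) * (k + 1)) * z powi (k + 1)) / z
          = - ((-1) powi k * (r ^ (2 * M + 1) * r powi ((k + 1) * (k + 1))) * z powi k)"
        using z by (simp add: field_simps)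
      also have "\<dots> = - R * B"
        unfolding e R_def by (simp add: mult_ac)
      finally show ?thesis .
    qed
    have t0: "T M k = R * ((1 - A) * a) * ((1 - B) * b)"
      by (simp add: T_def R_def e1 e2)
    have t1: "r ^ (2 * M + 1) * (z * T M (k + - 1)) = - R * A * a * ((1 - B / q) * (1 - B) * b)"
    proof -
      have "inv_qfin q (int M - (k + - 1)) = a"
        by (simp add: a_def algebra_simps)
      then have "r ^ (2 * M + 1) * (z * T M (k + - 1)) =
         (r ^ (2 * M + 1) * ((-1) powi (k + - 1) * r powi ((k + - 1) * (k + - 1)) * z powi (k + - 1)) * z)
          * a * ((1 - B / q) * (1 - B) * b)"
        unfolding T_def e4 by (simp only: mult_ac)
      then show ?thesis unfolding R1 .
    qed
    have t2: "r ^ (2 * M + 1) * (T M (k + 1) / z) = - R * B * ((1 - A / q) * (1 - A) * a) * b"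
    proof -
      have "inv_qfin q (int M + (k + 1)) = b"
        by (simp add: b_def algebra_simps)
      then have "r ^ (2 * M + 1) * (T M (k + 1) / z) =
         (r ^ (2 * M + 1) * ((-1) powi (k + 1) * r powi ((k + 1) * (k + 1)) * z powi (k + 1)) / z)
          * ((1 - A / q) * (1 - A) * a) * b"
        unfolding T_def e3 by (simp only: mult_ac times_divide_eq_left times_divide_eq_right)
      then show ?thesis unfolding R2 .
    qed
    have "T (Suc M) k = R * a * b"
      by (simp add: T_def R_def a_def b_def algebra_simps)
    moreover have "R * a * b * D = (1 + q ^ (2 * M + 1)) * T M k
       + (- (r ^ (2 * M + 1))) * (z * T M (k + - 1) + T M (k + 1) / z)"
    proof -
      have "(- (r ^ (2 * M + 1))) * (z * T M (k + - 1) + T M (k + 1) / z)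
         = - (r ^ (2 * M + 1) * (z * T M (k + - 1))) - r ^ (2 * M + 1) * (T M (k + 1) / z)"
        by (simp add: algebra_simps)
      also have "\<dots> = R * A * a * ((1 - B / q) * (1 - B) * b) + R * B * ((1 - A / q) * (1 - A) * a) * b"
        unfolding t1 t2 by simp
      finally have f: "(- (r ^ (2 * M + 1))) * (z * T M (k + - 1) + T M (k + 1) / z)
         = R * A * a * ((1 - B / q) * (1 - B) * b) + R * B * ((1 - A / q) * (1 - A) * a) * b" .
      have e5: "1 + q ^ (2 * M + 1) = 1 + A * B / q" and e6: "D = (1 - A * B / q) * (1 - A * B)"
        unfolding D_def AB AB' by (simp_all add: AB'[symmetric])
      show ?thesis
        unfolding f t0 e5 e6 using q0 by (simp add: field_simps)
    qed
    ultimately show ?thesis using D by (simp add: field_simps)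
  qed
  have "(T (Suc M) has_sum ((1 + q ^ (2 * M + 1)) * L
       + (- (r ^ (2 * M + 1))) * (z * L + L / z)) / D) UNIV"
    unfolding step[abs_def] divide_inverse
    by (intro has_sum_add has_sum_cmult_left has_sum_cmult_right shift IH)
  also have "((1 + q ^ (2 * M + 1)) * L + (- (r ^ (2 * M + 1))) * (z * L + L / z)) / D
      = L * ((1 - r ^ (2 * M + 1) * z) * (1 - r ^ (2 * M + 1) / z)) / D"
  proof -
    have "q ^ (2 * M + 1) = r ^ (2 * M + 1) * r ^ (2 * M + 1)"
      by (simp add: q_def power_mult_distrib power2_eq_square)
    then show ?thesis using z D by (simp add: field_simps)
  qed
  also have "\<dots> = (\<Prod>j<Suc M. (1 - r ^ (2 * j + 1) * z) * (1 - r ^ (2 * j + 1) / z)) / qfin q (2 * Suc M)"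
    by (simp add: L_def D_def qfin_def mult_ac)
  finally show ?case unfolding T_def .
qed

lemma tendsto_inv_qfin:
  assumes "norm q < 1"
  shows "(\<lambda>M. inv_qfin q (int M + c)) \<longlonglongrightarrow> 1 / qpoch q q"
proof -
  have nz: "qpoch q q \<noteq> 0" by (rule qpoch_nonzero[OF assms assms])
  have "(\<lambda>M. qfin q M) \<longlonglongrightarrow> qpoch q q"
    using qpoch_LIMSEQ[OF assms, of q] by (simp add: qfin_def)
  then have "(\<lambda>M. 1 / qfin q M) \<longlonglongrightarrow> 1 / qpoch q q"
    using nz by (intro tendsto_intros)
  moreover have "filterlim (\<lambda>M. nat (int M + c)) sequentially sequentially"
    unfolding filterlim_at_top
  proof
    fix Z
    show "eventually (\<lambda>M. Z \<le> nat (int M + c)) sequentially"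
      using eventually_ge_at_top[of "nat (int Z - c)"] by eventually_elim linarith
  qed
  ultimately have "(\<lambda>M. 1 / qfin q (nat (int M + c))) \<longlonglongrightarrow> 1 / qpoch q q"
    by (rule filterlim_compose)
  then show ?thesis
  proof (rule Lim_transform_eventually)
    show "eventually (\<lambda>M. 1 / qfin q (nat (int M + c)) = inv_qfin q (int M + c)) sequentially"
      using eventually_ge_at_top[of "nat (- c)"] by eventually_elim (simp add: inv_qfin_def)
  qed
qed

lemma inv_qfin_bounded:
  assumes "norm q < 1"
  obtains B where "\<And>m. norm (inv_qfin q m) \<le> B" "B \<ge> 0"
proof -
  have "Bseq (\<lambda>M. inv_qfin q (int M + 0))"
    by (rule convergent_imp_Bseq) (use tendsto_inv_qfin[OF assms, of 0] in \<open>auto simp: convergent_def\<close>)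
  then obtain B where B: "B > 0" "\<And>M. norm (inv_qfin q (int M)) \<le> B"
    by (auto simp: Bseq_def)
  have "norm (inv_qfin q m) \<le> B" for m
    using B(1) B(2)[of "nat m"] by (cases "m < 0") (auto simp: inv_qfin_def)
  with B(1) that[of B] show ?thesis by simp
qed

lemma has_sum_int_imp_sums:
  fixes f :: "int \<Rightarrow> 'a::banach"
  assumes "(f has_sum S) UNIV"
  shows "(\<lambda>i. f (int_decode i)) sums S"
  using assms has_sum_reindex_bij_betw[OF bij_int_decode, of f S]
  by (intro has_sum_imp_sums) (simp add: o_def)

text \<open>Tannery's theorem applied to the finite form, with the integers enumerated by
  \<open>int_decode\<close>. The reciprocals of \<open>qfin\<close> are bounded, so the Gaussian
  terms dominate. In the limit the series carries 1/Q^2 and the product 1/Q, with Q = (q;q), which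
  leaves one factor Q.\<close>

theorem jacobi_triple:
  assumes r: "r \<noteq> 0" "norm r < 1" and z: "z \<noteq> 0"
  shows "((\<lambda>k::int. (-1) powi k * r powi (k * k) * z powi k) has_sum
          (qpoch (r\<^sup>2) (r\<^sup>2) * theta r z)) UNIV"
proof -
  define q where "q = r\<^sup>2"
  have q: "norm q < 1"
    using r by (simp add: q_def norm_power power_less_one_iff)
  define t where "t = (\<lambda>k::int. (-1) powi k * r powi (k * k) * z powi k)"
  define Q where "Q = qpoch q q"
  have Q: "Q \<noteq> 0" unfolding Q_def by (rule qpoch_nonzero[OF q q])
  obtain B where B: "\<And>m. norm (inv_qfin q m) \<le> B" "B \<ge> 0"
    using inv_qfin_bounded[OF q] by blast
  have norm_t: "norm (t k) = norm (r powi (k * k) * z powi k)" for k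
    by (simp add: t_def norm_mult norm_power_int)
  have abs_t: "(\<lambda>k. norm (t k)) summable_on UNIV"
    unfolding norm_t by (rule summable_on_gauss[OF r z])
  define a where "a = (\<lambda>i M. t (int_decode i) * inv_qfin q (int M - int_decode i) * inv_qfin q (int M + int_decode i))"
  have lim: "(\<lambda>M. a i M) \<longlonglongrightarrow> t (int_decode i) * (1 / Q) * (1 / Q)" for i
    unfolding a_def Q_def
    using tendsto_inv_qfin[OF q, of "- int_decode i"] tendsto_inv_qfin[OF q, of "int_decode i"]
    by (intro tendsto_intros) auto
  have bound: "norm (a i M) \<le> norm (t (int_decode i)) * (B * B)" for i M
    unfolding a_def norm_mult mult.assoc
    by (intro mult_left_mono mult_mono B) auto
  obtain S where "((\<lambda>k. norm (t k)) has_sum S) UNIV"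
    using abs_t by (auto simp: summable_on_def)
  then have summ: "summable (\<lambda>i. norm (t (int_decode i)) * (B * B))"
    by (intro summable_mult2 sums_summable has_sum_int_imp_sums)
  have "(\<lambda>M. suminf (\<lambda>i. a i M)) \<longlonglongrightarrow> suminf (\<lambda>i. t (int_decode i) * (1 / Q) * (1 / Q))"
    using tannerys_theorem[OF lim _ summ] bound by (simp add: always_eventually)
  moreover have "suminf (\<lambda>i. a i M) = (\<Prod>j<M. (1 - r ^ (2 * j + 1) * z) * (1 - r ^ (2 * j + 1) / z)) / qfin q (2 * M)" for M
    using has_sum_int_imp_sums[OF finite_jacobi_triple[OF r z, of M]]
    unfolding a_def t_def q_def by (rule sums_unique[symmetric])
  moreover have "(\<lambda>M. (\<Prod>j<M. (1 - r ^ (2 * j + 1) * z) * (1 - r ^ (2 * j + 1) / z)) / qfin q (2 * M)) \<longlonglongrightarrow> theta r z / Q"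
  proof (rule tendsto_divide[OF _ _ Q])
    have "(\<lambda>M. (\<Prod>j<M. 1 - r * z * q ^ j) * (\<Prod>j<M. 1 - r / z * q ^ j)) \<longlonglongrightarrow> theta r z"
      unfolding theta_def q_def[symmetric] by (intro tendsto_mult qpoch_LIMSEQ q)
    then show "(\<lambda>M. \<Prod>j<M. (1 - r ^ (2 * j + 1) * z) * (1 - r ^ (2 * j + 1) / z)) \<longlonglongrightarrow> theta r z"
      by (simp add: prod.distrib q_def mult_ac flip: power_mult)
    have "(\<lambda>M. qfin q M) \<longlonglongrightarrow> Q"
      using qpoch_LIMSEQ[OF q, of q] by (simp add: qfin_def Q_def)
    then show "(\<lambda>M. qfin q (2 * M)) \<longlonglongrightarrow> Q"
      by (rule filterlim_compose) (intro filterlim_subseq strict_monoI, simp)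
  qed
  ultimately have "suminf (\<lambda>i. t (int_decode i) * (1 / Q) * (1 / Q)) = theta r z / Q"
    using LIMSEQ_unique by (metis (no_types, lifting) ext)
  moreover obtain T where T: "(t has_sum T) UNIV"
    using abs_summable_summable[OF abs_t] by (auto simp: summable_on_def)
  moreover have "(\<lambda>i. t (int_decode i) * (1 / Q) * (1 / Q)) sums (T * (1 / Q) * (1 / Q))"
    by (intro sums_mult2 has_sum_int_imp_sums T)
  ultimately have "T * (1 / Q) * (1 / Q) = theta r z / Q"
    by (simp add: sums_iff)
  then have "T = Q * theta r z"
    using Q by (simp add: field_simps)
  with T show ?thesis by (simp add: t_def Q_def q_def)
qed

text \<open>Summable complex families are absolutely summable, which supplies summability on the
  product set.\<close>

lemma has_sum_product_complex:
  fixes f :: "'a \<Rightarrow> complex" and g :: "'b \<Rightarrow> complex"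
  assumes f: "(f has_sum a) A" and g: "(g has_sum b) B"
  shows "((\<lambda>(x, y). f x * g y) has_sum (a * b)) (A \<times> B)"
proof (rule has_sum_SigmaI)
  show "((\<lambda>y. case (x, y) of (x, y) \<Rightarrow> f x * g y) has_sum f x * b) B" for x
    using has_sum_cmult_right[OF g] by simp
  show "((\<lambda>x. f x * b) has_sum a * b) A"
    by (rule has_sum_cmult_left[OF f])
  have "(\<lambda>x. norm (f x)) summable_on A" "(\<lambda>y. norm (g y)) summable_on B"
    using has_sum_imp_summable[OF f] has_sum_imp_summable[OF g]
    by (simp_all only: summable_on_iff_abs_summable_on_complex)
  then have "(\<lambda>p. norm (case p of (x, y) \<Rightarrow> f x * g y)) summable_on A \<times> B"
    by (subst Infinite_Sum.abs_summable_on_Sigma_iff)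
       (auto simp: norm_mult infsum_cmult_right' abs_mult
             intro!: summable_on_cmult_right summable_on_cmult_left)
  then show "(\<lambda>(x, y). f x * g y) summable_on A \<times> B"
    by (rule abs_summable_summable)
qed

text \<open>The coefficients of a product of thetas satisfy a two-term recurrence because the product is
  quasi-periodic under \<open>z \<mapsto> r\<^sup>2 z\<close>.\<close>

lemma prod_theta_laurent:
  assumes r: "r \<noteq> 0" "norm r < 1" and fin: "finite I" and b: "\<And>i. i \<in> I \<Longrightarrow> b i \<noteq> 0"
  shows "\<exists>c :: int \<Rightarrow> complex. (\<forall>z. z \<noteq> 0 \<longrightarrow> ((\<lambda>k. c k * z powi k) has_sum (\<Prod>i\<in>I. theta r (b i * z))) UNIV)
     \<and> (\<forall>k. c (k + int (card I)) = (- r) ^ card I * (\<Prod>i\<in>I. b i) * r powi (2 * k) * c k)"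
  using fin b
proof (induction I rule: finite_induct)
  case empty
  have "((\<lambda>k. (if k = 0 then 1 else 0) * z powi k) has_sum 1) UNIV" for z :: complex
    by (rule has_sum_finite_neutralI[where B = "{0}"]) auto
  then show ?case by (intro exI[of _ "\<lambda>k. if k = 0 then 1 else 0"]) auto
next
  case (insert x I)
  define Q where "Q = qpoch (r\<^sup>2) (r\<^sup>2)"
  have nq: "norm (r\<^sup>2) < 1"
    using r by (simp add: norm_power power_less_one_iff)
  have Q: "Q \<noteq> 0" unfolding Q_def by (rule qpoch_nonzero[OF nq nq])
  from insert obtain c where c: "\<And>z. z \<noteq> 0 \<Longrightarrow> ((\<lambda>k. c k * z powi k) has_sum (\<Prod>i\<in>I. theta r (b i * z))) UNIV"
     "\<And>k. c (k + int (card I)) = (- r) ^ card I * (\<Prod>i\<in>I. b i) * r powi (2 * k) * c k" by blast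
  define t where "t = (\<lambda>m::int. (-1) powi m * r powi (m * m) * b x powi m / Q)"
  have bx: "b x \<noteq> 0" using insert by auto
  have t: "((\<lambda>m. t m * z powi m) has_sum theta r (b x * z)) UNIV" if "z \<noteq> 0" for z
    using has_sum_cmult_left[OF jacobi_triple[OF r, of "b x * z"], of "1 / Q"] that bx Q
    by (simp add: t_def Q_def power_int_mult_distrib mult_ac)
  have t_rec: "t (m + 1) = - r * b x * r powi (2 * m) * t m" for m
  proof -
    have "(m + 1) * (m + 1) = m * m + 2 * m + 1" by (simp add: algebra_simps)
    then show ?thesis
      using r bx by (simp add: t_def power_int_add)
  qed
  \<comment> \<open>Cauchy product: \<open>d k\<close> collects the terms of total exponent
    \<open>k\<close>. Its own convergence is read off from the double family at
    \<open>z = 1\<close>.\<close>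
  define d where "d = (\<lambda>k. \<Sum>\<^sub>\<infinity>m. t m * c (k - m))"
  have main: "((\<lambda>m. t m * c (k - m)) has_sum d k) UNIV
     \<and> ((\<lambda>k. d k * z powi k) has_sum (\<Prod>i\<in>insert x I. theta r (b i * z))) UNIV" if z: "z \<noteq> 0" for z k
  proof -
    define P where "P = theta r (b x * z) * (\<Prod>i\<in>I. theta r (b i * z))"
    have "((\<lambda>(m, k). (t m * z powi m) * (c k * z powi k)) has_sum P) (UNIV \<times> UNIV)"
      unfolding P_def by (intro has_sum_product_complex t c z)
    moreover have "bij_betw (\<lambda>(k, m). (m, k - m)) (UNIV \<times> UNIV) (UNIV \<times> UNIV :: (int \<times> int) set)"
      by (rule bij_betwI[where g = "\<lambda>(m, k). (m + k, m)"]) auto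
    ultimately have "((\<lambda>p. case (case p of (k, m) \<Rightarrow> (m, k - m)) of (m, k) \<Rightarrow> (t m * z powi m) * (c k * z powi k)) has_sum P) (UNIV \<times> UNIV)"
      by (subst has_sum_reindex_bij_betw)
    then have *: "((\<lambda>(k, m). t m * c (k - m) * z powi k) has_sum P) (UNIV \<times> UNIV)"
      by (rule has_sum_cong[THEN iffD1, rotated]) (auto simp: power_int_diff z)
    have inner: "((\<lambda>m. t m * c (k - m) * z powi k) has_sum (d k * z powi k)) UNIV" for k
    proof -
      have "(\<lambda>(k, m). t m * c (k - m) * z powi k) summable_on (\<lambda>m. (k, m)) ` UNIV"
        by (rule summable_on_subset_banach[OF has_sum_imp_summable[OF *]]) auto
      then have "(\<lambda>m. t m * c (k - m) * z powi k) summable_on UNIV"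
        by (subst (asm) summable_on_reindex) (auto simp: inj_on_def o_def)
      then have "(\<lambda>m. t m * c (k - m)) summable_on UNIV"
        using z by (subst (asm) summable_on_cmult_left') auto
      then show ?thesis
        unfolding d_def by (intro has_sum_cmult_left has_sum_infsum)
    qed
    have "((\<lambda>k. d k * z powi k) has_sum P) UNIV"
      by (rule has_sum_SigmaD[OF *]) (use inner in simp)
    moreover have "((\<lambda>m. t m * c (k - m)) has_sum d k) UNIV" for k
      using has_sum_cmult_left[OF inner[of k], of "inverse (z powi k)"] z by (simp add: mult.assoc)
    ultimately show ?thesis
      using insert.hyps by (simp add: P_def)
  qed
  have "d (k + int (Suc (card I))) = (- r) ^ Suc (card I) * ((\<Prod>i\<in>I. b i) * b x) * r powi (2 * k) * d k" for k
  proof (rule has_sum_unique)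
    have dk: "((\<lambda>m. t m * c (k - m)) has_sum d k) UNIV" for k
      using main[of 1] by simp
    \<comment> \<open>The shift by \<open>card I + 1\<close> is split into a shift by 1 in
      \<open>t\<close> and by \<open>card I\<close> in \<open>c\<close>. The two powers of
      \<open>r\<close> multiply to \<open>r powi (2 * k)\<close>, which is free of \<open>m\<close>,
      so the factor leaves the sum.\<close>
    have "((\<lambda>m. t (m + 1) * c (k + int (Suc (card I)) - (m + 1))) has_sum d (k + int (Suc (card I)))) UNIV"
      using has_sum_reindex_bij_betw[of "\<lambda>m::int. m + 1" UNIV UNIV
         "\<lambda>m. t m * c (k + int (Suc (card I)) - m)"] dk[of "k + int (Suc (card I))"]
      by (simp add: bij_plus_right)
    moreover have "t (m + 1) * c (k + int (Suc (card I)) - (m + 1))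
       = (- r) ^ Suc (card I) * ((\<Prod>i\<in>I. b i) * b x) * r powi (2 * k) * (t m * c (k - m))" for m
    proof -
      have "k + int (Suc (card I)) - (m + 1) = k - m + int (card I)" by simp
      moreover have "r powi (2 * m) * r powi (2 * (k - m)) = r powi (2 * k)"
        using r by (simp flip: power_int_add)
      ultimately show ?thesis
        unfolding t_rec by (simp only: c(2)) (simp add: mult_ac)
    qed
    ultimately show "((\<lambda>m. (- r) ^ Suc (card I) * ((\<Prod>i\<in>I. b i) * b x) * r powi (2 * k) * (t m * c (k - m)))
        has_sum d (k + int (Suc (card I)))) UNIV"
      by simp
    show "((\<lambda>m. (- r) ^ Suc (card I) * ((\<Prod>i\<in>I. b i) * b x) * r powi (2 * k) * (t m * c (k - m)))
        has_sum (- r) ^ Suc (card I) * ((\<Prod>i\<in>I. b i) * b x) * r powi (2 * k) * d k) UNIV"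
      by (intro has_sum_cmult_right dk)
  qed
  then show ?case
    using main insert.hyps by (intro exI[of _ d]) (auto simp: mult_ac)
qed

section \<open>Roots of unity\<close>

text \<open>Two monic polynomials of degree n with n common roots: their difference has smaller
  degree and too many roots.\<close>

lemma prod_roots_unity_poly:
  assumes "n > 0"
  shows "(\<Prod>\<zeta>\<in>{\<zeta>::complex. \<zeta> ^ n = 1}. x - \<zeta>) = x ^ n - 1"
proof -
  define R where "R = {\<zeta>::complex. \<zeta> ^ n = 1}"
  have card: "card R = n" "finite R"
    using assms card_roots_unity_eq[of n] finite_nth_roots[of n 1] by (auto simp: R_def)
  define P where "P = (\<Prod>\<zeta>\<in>R. [:- \<zeta>, 1:])"
  define p where "p = monom 1 n - 1 - P"
  have "degree P = n"
    unfolding P_def by (subst degree_prod_eq_sum_degree) (auto simp: card)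
  moreover have "lead_coeff P = 1"
    unfolding P_def by (simp add: lead_coeff_prod)
  ultimately have "coeff P n = 1" by simp
  then have c: "coeff p n = 0"
    using assms by (simp add: p_def coeff_1)
  have "degree p \<le> n"
    unfolding p_def using \<open>degree P = n\<close> by (intro degree_diff_le degree_monom_le) auto
  with c have deg: "degree p < n \<or> p = 0"
    by (metis le_neq_implies_less leading_coeff_0_iff)
  have "R \<subseteq> {x. poly p x = 0}"
    using card by (auto simp: p_def P_def poly_monom poly_prod R_def)
  then have "p = 0"
    using deg card poly_roots_finite[of p] card_poly_roots_bound[of p]
    by (meson card_mono leD order.trans)
  then have "poly P x = x ^ n - 1"
    unfolding p_def by (metis (no_types) diff_eq_diff_eq diff_zero eq_iff_diff_eq_0 poly_1 poly_diff poly_monom mult_1)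
  then show ?thesis by (simp add: P_def poly_prod R_def)
qed

lemma prod_roots_unity:
  assumes "n > 0"
  shows "(\<Prod>\<zeta>\<in>{\<zeta>::complex. \<zeta> ^ n = 1}. \<zeta>) = (-1) ^ (n - 1)"
proof -
  have "card {\<zeta>::complex. \<zeta> ^ n = 1} = n" using assms by (simp add: card_roots_unity_eq)
  then have "(-1) ^ n * (\<Prod>\<zeta>\<in>{\<zeta>::complex. \<zeta> ^ n = 1}. \<zeta>) = (\<Prod>\<zeta>\<in>{\<zeta>::complex. \<zeta> ^ n = 1}. (-1) * \<zeta>)"
    by (simp only: prod.distrib prod_constant)
  also have "\<dots> = -1"
    using prod_roots_unity_poly[OF assms, of 0] assms by simp
  finally have "(-1) ^ n * ((-1) ^ n * (\<Prod>\<zeta>\<in>{\<zeta>::complex. \<zeta> ^ n = 1}. \<zeta>)) = (-1) ^ n * (-1)"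
    by simp
  then show ?thesis
    using assms by (cases n) (auto simp flip: mult.assoc power_mult_distrib)
qed

lemma prod_one_minus_roots_unity:
  assumes "n > 0"
  shows "(\<Prod>\<zeta>\<in>{\<zeta>::complex. \<zeta> ^ n = 1}. 1 - x * \<zeta>) = 1 - x ^ n"
proof (cases "x = 0")
  case False
  have card: "card {\<zeta>::complex. \<zeta> ^ n = 1} = n" using assms by (simp add: card_roots_unity_eq)
  have "(\<Prod>\<zeta>\<in>{\<zeta>::complex. \<zeta> ^ n = 1}. 1 - x * \<zeta>) = (\<Prod>\<zeta>\<in>{\<zeta>::complex. \<zeta> ^ n = 1}. x * (1 / x - \<zeta>))"
    using False by (intro prod.cong) (auto simp: field_simps)
  also have "\<dots> = x ^ n * ((1 / x) ^ n - 1)"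
    by (simp only: prod.distrib prod_constant card prod_roots_unity_poly[OF assms])
  also have "\<dots> = 1 - x ^ n"
    using False by (simp add: field_simps)
  finally show ?thesis .
qed (use assms in auto)

text \<open>Factor by factor this is the factorization of 1 - x^n. It evaluates the infinite
  products of the kernel when the variables run through all roots of unity.\<close>

lemma prod_qpoch_roots_unity:
  assumes "norm q < 1" "n > 0"
  shows "(\<Prod>\<zeta>\<in>{\<zeta>. \<zeta> ^ n = 1}. qpoch (a * \<zeta>) q) = qpoch (a ^ n) (q ^ n)"
proof (rule LIMSEQ_unique)
  have qn: "norm (q ^ n) < 1"
    using assms by (simp add: norm_power power_less_one_iff)
  show "(\<lambda>M. \<Prod>\<zeta>\<in>{\<zeta>. \<zeta> ^ n = 1}. \<Prod>k<M. 1 - a * \<zeta> * q ^ k) \<longlonglongrightarrow> (\<Prod>\<zeta>\<in>{\<zeta>. \<zeta> ^ n = 1}. qpoch (a * \<zeta>) q)"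
    by (intro tendsto_prod qpoch_LIMSEQ assms)
  have "(\<Prod>\<zeta>\<in>{\<zeta>. \<zeta> ^ n = 1}. \<Prod>k<M. 1 - a * \<zeta> * q ^ k) = (\<Prod>k<M. 1 - a ^ n * (q ^ n) ^ k)" for M
  proof (subst prod.swap, rule prod.cong[OF refl])
    fix k
    show "(\<Prod>\<zeta>\<in>{\<zeta>. \<zeta> ^ n = 1}. 1 - a * \<zeta> * q ^ k) = 1 - a ^ n * (q ^ n) ^ k"
      using prod_one_minus_roots_unity[OF assms(2), of "a * q ^ k"]
      by (simp add: power_mult_distrib mult_ac flip: power_mult)
  qed
  then show "(\<lambda>M. \<Prod>\<zeta>\<in>{\<zeta>. \<zeta> ^ n = 1}. \<Prod>k<M. 1 - a * \<zeta> * q ^ k) \<longlonglongrightarrow> qpoch (a ^ n) (q ^ n)"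
    using qpoch_LIMSEQ[OF qn] by simp
qed

section \<open>Theta functions of degree n\<close>

text \<open>The solution of \<open>c (p + n) = - r ^ (2 p + 1) * c p\<close> with \<open>c p = 1\<close> for \<open>0 \<le> p < n\<close>.\<close>

definition theta_coeff :: "complex \<Rightarrow> nat \<Rightarrow> int \<Rightarrow> complex" where
  "theta_coeff r n p = (let m = p div int n; j = p mod int n in
     (-1) powi m * r powi (int n * m * m + (2 * j + 1 - int n) * m))"

text \<open>A Laurent series with f(r^2 z) = - f(z) / (r z^n) has coefficients obeying the
  recurrence of \<open>theta_coeff\<close>, so those at exponents 0, ..., n-1 are free. For j < n
  this is the solution supported on exponents congruent to j, with coefficient 1 at z^j.\<close>

definition theta_basis :: "complex \<Rightarrow> nat \<Rightarrow> nat \<Rightarrow> complex \<Rightarrow> complex" where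
  "theta_basis r n j z = (\<Sum>\<^sub>\<infinity>m::int. theta_coeff r n (int j + int n * m) * z powi (int j + int n * m))"

text \<open>The recurrence iterated \<open>b\<close> times, for either sign of \<open>b\<close>. The
  exponent is quadratic in \<open>m\<close>, and the mixed term 2 n m b turns 2 j into 2 p, because
  p = n m + j.\<close>

lemma theta_coeff_shift:
  assumes "r \<noteq> 0" "n > 0"
  shows "theta_coeff r n (p + int n * b) =
    theta_coeff r n p * (-1) powi b * r powi (int n * b * b + (2 * p + 1 - int n) * b)"
proof -
  define m where "m = p div int n"
  define j where "j = p mod int n"
  have p: "p = int n * m + j" by (simp add: m_def j_def)
  have "(p + int n * b) div int n = m + b" "(p + int n * b) mod int n = j"
    using assms by (simp_all add: m_def j_def)
  then have "theta_coeff r n (p + int n * b) =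
     (-1) powi (m + b) * r powi (int n * (m + b) * (m + b) + (2 * j + 1 - int n) * (m + b))"
    by (simp add: theta_coeff_def Let_def)
  also have "int n * (m + b) * (m + b) + (2 * j + 1 - int n) * (m + b) =
     (int n * m * m + (2 * j + 1 - int n) * m) + (int n * b * b + (2 * p + 1 - int n) * b)"
    unfolding p by (simp add: algebra_simps)
  also have "(-1) powi (m + b) * r powi \<dots> = ((-1) powi m * r powi (int n * m * m + (2 * j + 1 - int n) * m))
     * (-1) powi b * r powi (int n * b * b + (2 * p + 1 - int n) * b)"
    using assms by (simp add: power_int_add)
  also have "(-1) powi m * r powi (int n * m * m + (2 * j + 1 - int n) * m) = theta_coeff r n p"
    by (simp add: theta_coeff_def Let_def m_def j_def)
  finally show ?thesis .
qed

lemma theta_coeff_base: "0 \<le> p \<Longrightarrow> p < int n \<Longrightarrow> theta_coeff r n p = 1"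
  by (simp add: theta_coeff_def)

lemma theta_basis_has_sum:
  assumes "r \<noteq> 0" "norm r < 1" "n > 0" "z \<noteq> 0"
  shows "((\<lambda>m::int. theta_coeff r n (int j + int n * m) * z powi (int j + int n * m)) has_sum theta_basis r n j z) UNIV"
proof -
  define y where "y = r powi (2 * int j + 1 - int n) * z ^ n"
  have rn: "norm (r ^ n) < 1" "r ^ n \<noteq> 0"
    using assms by (auto simp: norm_power power_less_one_iff)
  have "theta_coeff r n (int j + int n * m) * z powi (int j + int n * m) =
      (theta_coeff r n (int j) * z ^ j) * ((-1) powi m * (r ^ n) powi (m * m) * y powi m)" for m
  proof -
    have "r powi (int n * m * m + (2 * int j + 1 - int n) * m) = (r ^ n) powi (m * m) * r powi ((2 * int j + 1 - int n) * m)"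
      using assms by (simp add: power_int_add power_int_mult mult.assoc)
    moreover have "z powi (int j + int n * m) = z ^ j * (z ^ n) powi m"
      using assms by (simp add: power_int_add power_int_mult)
    moreover have "y powi m = r powi ((2 * int j + 1 - int n) * m) * (z ^ n) powi m"
      by (simp add: y_def power_int_mult_distrib power_int_mult)
    ultimately show ?thesis
      unfolding theta_coeff_shift[OF assms(1,3)] by (simp only: mult_ac)
  qed
  moreover have "y \<noteq> 0" using assms by (simp add: y_def)
  ultimately have "(\<lambda>m::int. theta_coeff r n (int j + int n * m) * z powi (int j + int n * m)) summable_on UNIV"
    by (simp only:) (intro summable_on_cmult_right has_sum_imp_summable[OF jacobi_triple[OF rn(2,1)]])
  then show ?thesis
    unfolding theta_basis_def by (rule has_sum_infsum)
qed

text \<open>All exponents of the series are congruent to \<open>j\<close> mod \<open>n\<close>.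
  Hence on roots of unity the matrix of basis values is a Vandermonde matrix up to a constant factor
  for each \<open>j\<close>.\<close>

lemma theta_basis_root_unity:
  assumes "r \<noteq> 0" "norm r < 1" "n > 0" "\<zeta> ^ n = 1"
  shows "theta_basis r n j \<zeta> = \<zeta> ^ j * theta_basis r n j 1"
proof -
  have z: "\<zeta> \<noteq> 0" using assms by (auto simp: power_0_left)
  have e: "\<zeta> powi (int j + int n * m) = \<zeta> ^ j * 1 powi (int j + int n * m)" for m
    using assms z by (simp add: power_int_add power_int_mult)
  have "((\<lambda>m::int. \<zeta> ^ j * (theta_coeff r n (int j + int n * m) * 1 powi (int j + int n * m))) has_sum \<zeta> ^ j * theta_basis r n j 1) UNIV"
    using assms by (intro has_sum_cmult_right theta_basis_has_sum) auto
  then have "((\<lambda>m::int. theta_coeff r n (int j + int n * m) * \<zeta> powi (int j + int n * m)) has_sum \<zeta> ^ j * theta_basis r n j 1) UNIV"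
    unfolding e by (simp add: mult_ac)
  then show ?thesis
    using theta_basis_has_sum[OF assms(1-3) z, of j] has_sum_unique by blast
qed

text \<open>The triple product with \<open>r ^ n\<close> in place of \<open>r\<close> and argument y
  = r^(2j+1-n); then r^n y and r^n / y are r q^j and r q^(n-1-j).\<close>

lemma theta_basis_1:
  assumes r: "r \<noteq> 0" "norm r < 1" and j: "j < n"
  defines "q \<equiv> r\<^sup>2"
  shows "theta_basis r n j 1 = qpoch (q ^ n) (q ^ n) * (qpoch (r * q ^ j) (q ^ n) * qpoch (r * q ^ (n - 1 - j)) (q ^ n))"
proof -
  define y where "y = r powi (2 * int j + 1 - int n)"
  have n: "n > 0" using j by simp
  have rn: "norm (r ^ n) < 1" "r ^ n \<noteq> 0"
    using r n by (auto simp: norm_power power_less_one_iff)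
  have y: "y \<noteq> 0" using r by (simp add: y_def)
  have "theta_coeff r n (int j + int n * m) * 1 powi (int j + int n * m) =
      (-1) powi m * (r ^ n) powi (m * m) * y powi m" for m
  proof -
    have "r powi (int n * m * m + (2 * int j + 1 - int n) * m) = (r ^ n) powi (m * m) * r powi ((2 * int j + 1 - int n) * m)"
      using r by (simp add: power_int_add power_int_mult mult.assoc)
    then show ?thesis
      using r j by (simp add: theta_coeff_shift theta_coeff_base y_def power_int_mult)
  qed
  then have "theta_basis r n j 1 = qpoch ((r ^ n)\<^sup>2) ((r ^ n)\<^sup>2) * theta (r ^ n) y"
    using theta_basis_has_sum[OF r n, of 1 j] jacobi_triple[OF rn(2,1) y] has_sum_unique
    by simp blast
  moreover have "(r ^ n)\<^sup>2 = q ^ n"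
    by (simp add: q_def mult.commute flip: power_mult)
  moreover have "r ^ n * y = r * q ^ j"
  proof -
    have "r ^ n * y = r powi (int n + (2 * int j + 1 - int n))"
      unfolding y_def power_int_add[OF disjI1[OF r(1)]] by simp
    also have "int n + (2 * int j + 1 - int n) = int (Suc (2 * j))" by simp
    also have "r powi int (Suc (2 * j)) = r * q ^ j"
      unfolding power_int_of_nat by (simp add: q_def power_mult)
    finally show ?thesis .
  qed
  moreover have "r ^ n / y = r * q ^ (n - 1 - j)"
  proof -
    have "r ^ n / y = r powi (int n - (2 * int j + 1 - int n))"
      unfolding y_def power_int_diff[OF disjI1[OF r(1)]] by simp
    also have "int n - (2 * int j + 1 - int n) = int (Suc (2 * (n - 1 - j)))"
      using j by linarith
    also have "r powi int (Suc (2 * (n - 1 - j))) = r * q ^ (n - 1 - j)"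
      unfolding power_int_of_nat by (simp add: q_def power_mult)
    finally show ?thesis .
  qed
  ultimately show ?thesis
    by (simp add: theta_def)
qed

lemma theta_basis_1_nonzero:
  assumes r: "r \<noteq> 0" "norm r < 1" and j: "j < n"
  shows "theta_basis r n j 1 \<noteq> 0"
proof -
  have q: "norm ((r\<^sup>2) ^ n) < 1"
    using r j by (simp add: norm_power power_less_one_iff flip: power_mult)
  have "norm (r * (r\<^sup>2) ^ k) < 1" for k
    using r by (simp add: norm_power power_less_one_iff flip: power_mult power_Suc norm_mult del: norm_mult)
  then show ?thesis
    unfolding theta_basis_1[OF assms] using q qpoch_nonzero by simp
qed

text \<open>As j runs through all residues, the products to base q^n reassemble into (r;q), once
  from r q^j and once from r q^(n-1-j).\<close>

lemma prod_theta_basis_1: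
  assumes r: "r \<noteq> 0" "norm r < 1" and n: "n > 0"
  shows "(\<Prod>j<n. theta_basis r n j 1) = qpoch ((r\<^sup>2) ^ n) ((r\<^sup>2) ^ n) ^ n * theta r 1"
proof -
  have q: "norm (r\<^sup>2) < 1"
    using r by (simp add: norm_power power_less_one_iff)
  have "(\<Prod>j<n. qpoch (r * (r\<^sup>2) ^ (n - 1 - j)) ((r\<^sup>2) ^ n)) = (\<Prod>j<n. qpoch (r * (r\<^sup>2) ^ j) ((r\<^sup>2) ^ n))"
    using prod.nat_diff_reindex[of "\<lambda>j. qpoch (r * (r\<^sup>2) ^ j) ((r\<^sup>2) ^ n)" n] by simp
  then show ?thesis
    using theta_basis_1[OF r] prod_qpoch_powers[OF q n, of r]
    by (simp add: prod.distrib theta_def)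
qed

text \<open>Defined as a span and not by the functional equation, so that membership is algebraic
  and no analyticity has to be tracked. Values at \<open>z = 0\<close> are left
  unconstrained.\<close>

definition theta_space :: "complex \<Rightarrow> nat \<Rightarrow> (complex \<Rightarrow> complex) set" where
  "theta_space r n = {f. \<exists>a. \<forall>z. z \<noteq> 0 \<longrightarrow> f z = (\<Sum>j<n. a j * theta_basis r n j z)}"

lemma theta_basis_in_space: "j < n \<Longrightarrow> theta_basis r n j \<in> theta_space r n"
  unfolding theta_space_def
  by (auto intro!: exI[of _ "\<lambda>i. if i = j then 1 else 0"] simp: if_distrib[of "\<lambda>x. x * _"] cong: if_cong)

lemma theta_space_cmult:
  assumes "f \<in> theta_space r n"
  shows "(\<lambda>z. c * f z) \<in> theta_space r n"
proof -
  from assms obtain a where "\<And>z. z \<noteq> 0 \<Longrightarrow> f z = (\<Sum>j<n. a j * theta_basis r n j z)"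
    by (auto simp: theta_space_def)
  then show ?thesis
    unfolding theta_space_def
    by (auto intro!: exI[of _ "\<lambda>j. c * a j"] simp: sum_distrib_left mult_ac)
qed

lemma theta_space_add:
  assumes "f \<in> theta_space r n" "g \<in> theta_space r n"
  shows "(\<lambda>z. f z + g z) \<in> theta_space r n"
proof -
  from assms obtain a b where "\<And>z. z \<noteq> 0 \<Longrightarrow> f z = (\<Sum>j<n. a j * theta_basis r n j z)"
      "\<And>z. z \<noteq> 0 \<Longrightarrow> g z = (\<Sum>j<n. b j * theta_basis r n j z)"
    unfolding theta_space_def by blast
  then show ?thesis
    unfolding theta_space_def
    by (auto intro!: exI[of _ "\<lambda>j. a j + b j"] simp: sum.distrib ring_distribs)
qed

lemma theta_space_sum:
  assumes "\<And>i. i \<in> I \<Longrightarrow> f i \<in> theta_space r n"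
  shows "(\<lambda>z. \<Sum>i\<in>I. f i z) \<in> theta_space r n"
proof -
  have "(\<lambda>z. 0) \<in> theta_space r n"
    unfolding theta_space_def by (auto intro!: exI[of _ "\<lambda>_. 0"])
  then show ?thesis
    using assms by (induction I rule: infinite_finite_induct) (auto intro: theta_space_add)
qed

text \<open>The condition on the product of the \<open>b i\<close> turns the recurrence of
  \<open>prod_theta_laurent\<close> into that of \<open>theta_coeff\<close>. In each residue class
  mod \<open>n\<close> the coefficients are then a multiple of those of one basis series.\<close>

lemma prod_theta_in_space:
  assumes r: "r \<noteq> 0" "norm r < 1" and I: "finite I" "card I = n" "n > 0"
    and b: "\<And>i. i \<in> I \<Longrightarrow> b i \<noteq> 0" "(- r) ^ n * (\<Prod>i\<in>I. b i) = - r"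
  shows "(\<lambda>z. \<Prod>i\<in>I. theta r (b i * z)) \<in> theta_space r n"
proof -
  from prod_theta_laurent[OF r I(1), of b] b(1) obtain c
    where c: "\<And>z. z \<noteq> 0 \<Longrightarrow> ((\<lambda>k. c k * z powi k) has_sum (\<Prod>i\<in>I. theta r (b i * z))) UNIV"
      and "\<And>k. c (k + int (card I)) = (- r) ^ card I * (\<Prod>i\<in>I. b i) * r powi (2 * k) * c k"
    by blast
  then have rec: "c (k + int n) = - r * r powi (2 * k) * c k" for k
    using I b(2) by simp
  have rec': "theta_coeff r n (k + int n) = - r * r powi (2 * k) * theta_coeff r n k" for k
    using theta_coeff_shift[OF r(1) I(3), of k 1] r by (simp add: power_int_add)
  have c_eq: "c (int j + int n * m) = c (int j) * theta_coeff r n (int j + int n * m)" if "j < n" for j m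
  proof (induction m rule: int_induct[where k = 0])
    case base
    then show ?case using that by (simp add: theta_coeff_base)
  next
    case (step1 i)
    have "int j + int n * (i + 1) = (int j + int n * i) + int n" by (simp add: algebra_simps)
    then show ?case by (simp only: rec rec' step1) (simp only: mult_ac)
  next
    case (step2 i)
    have "int j + int n * i = (int j + int n * (i - 1)) + int n" by (simp add: algebra_simps)
    then have "- r * r powi (2 * (int j + int n * (i - 1))) * c (int j + int n * (i - 1)) =
       - r * r powi (2 * (int j + int n * (i - 1))) * (c (int j) * theta_coeff r n (int j + int n * (i - 1)))"
      using step2(2) by (simp only: rec rec') (simp only: mult_ac)
    then show ?case using r by simp
  qed
  have "(\<Prod>i\<in>I. theta r (b i * z)) = (\<Sum>j<n. c (int j) * theta_basis r n j z)" if z: "z \<noteq> 0" for z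
  proof -
    have "bij_betw (\<lambda>(j, m). int j + int n * m) ({..<n} \<times> UNIV) UNIV"
      by (rule bij_betwI[where g = "\<lambda>p. (nat (p mod int n), p div int n)"])
         (use I(3) in \<open>auto simp: nat_less_iff\<close>)
    then have "((\<lambda>x. (\<lambda>k. c k * z powi k) (case x of (j, m) \<Rightarrow> int j + int n * m)) has_sum (\<Prod>i\<in>I. theta r (b i * z))) ({..<n} \<times> UNIV)"
      using c[OF z] by (subst has_sum_reindex_bij_betw)
    then have "((\<lambda>j. c (int j) * theta_basis r n j z) has_sum (\<Prod>i\<in>I. theta r (b i * z))) {..<n}"
    proof (rule has_sum_SigmaD)
      fix j assume "j \<in> {..<n}"
      then show "((\<lambda>m. (\<lambda>k. c k * z powi k) (case (j, m) of (j, m) \<Rightarrow> int j + int n * m)) has_sum c (int j) * theta_basis r n j z) UNIV"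
        using has_sum_cmult_right[OF theta_basis_has_sum[OF r I(3) z, of j], of "c (int j)"]
        by (simp add: c_eq mult.assoc)
    qed
    then show ?thesis
      by (rule has_sum_unique[OF _ has_sum_finite]) simp
  qed
  then show ?thesis
    unfolding theta_space_def mem_Collect_eq by (intro exI[of _ "\<lambda>j. c (int j)"] allI impI)
qed

text \<open>On the n-th roots of unity f agrees with a polynomial of degree below n, which therefore
  has n zeros and vanishes. Its coefficients are a_j Theta_j(1), and Theta_j(1) is nonzero.\<close>

lemma theta_space_zero:
  assumes r: "r \<noteq> 0" "norm r < 1" and n: "n > 0" and f: "f \<in> theta_space r n"
    and zero: "\<And>\<zeta>. \<zeta> ^ n = 1 \<Longrightarrow> f \<zeta> = 0" and z: "z \<noteq> 0"
  shows "f z = 0"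
proof -
  from f obtain a where a: "\<And>z. z \<noteq> 0 \<Longrightarrow> f z = (\<Sum>j<n. a j * theta_basis r n j z)"
    by (auto simp: theta_space_def)
  define b where "b = (\<lambda>j. a j * theta_basis r n j 1)"
  have "(\<Sum>j\<le>n - 1. b j * \<zeta> ^ j) = 0" if "\<zeta> ^ n = 1" for \<zeta>
  proof -
    have "\<zeta> \<noteq> 0" using that n by (auto simp: power_0_left)
    then have "(\<Sum>j<n. b j * \<zeta> ^ j) = f \<zeta>"
      using a theta_basis_root_unity[OF r n that] by (auto simp: b_def mult_ac intro!: sum.cong)
    moreover have "{..n - 1} = {..<n}" using n by auto
    ultimately show ?thesis using zero[OF that] by simp
  qed
  then have sub: "{\<zeta>. \<zeta> ^ n = 1} \<subseteq> {\<zeta>. (\<Sum>j\<le>n - 1. b j * \<zeta> ^ j) = 0}" by auto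
  have "b j = 0" if "j < n" for j
  proof (rule ccontr)
    assume "b j \<noteq> 0"
    then have "\<exists>k\<le>n - 1. b k \<noteq> 0" using that by (intro exI[of _ j]) auto
    from polyfun_rootbound[OF this] have "card {\<zeta>::complex. \<zeta> ^ n = 1} \<le> n - 1"
      using card_mono[OF _ sub] by linarith
    then show False using n card_roots_unity_eq[of n] by simp
  qed
  note b0 = this
  have "a j = 0" if "j < n" for j
    using b0[OF that] theta_basis_1_nonzero[OF r that] by (simp add: b_def)
  then show ?thesis using a[OF z] by simp
qed

text \<open>The diagonal factors \<open>i = j\<close> of the last product are kept because they normalize the constant in
  the determinant formula below to 1.\<close>

definition theta_kernel :: "complex \<Rightarrow> nat \<Rightarrow> (nat \<Rightarrow> complex) \<Rightarrow> complex" where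
  "theta_kernel r n u = theta r ((-1) ^ (n - 1) * (\<Prod>i<n. u i)) * (\<Prod>j<n. \<Prod>i<j. u j - u i)
     * (\<Prod>i<n. \<Prod>j<n. qpoch (r\<^sup>2 * (u i / u j)) (r\<^sup>2))"

text \<open>A Vandermonde factor and the two infinite products belonging to the same pair of
  variables combine into a single theta function of \<open>z\<close>.\<close>

lemma theta_factor:
  assumes "r \<noteq> 0" "norm r < 1" "z \<noteq> 0" "w \<noteq> 0"
  shows "(1 - z / w) * (qpoch (r\<^sup>2 * (z / w)) (r\<^sup>2) * qpoch (r\<^sup>2 * (w / z)) (r\<^sup>2)) = theta r (1 / (r * w) * z)"
proof -
  have "norm (r\<^sup>2) < 1" using assms by (simp add: norm_power power_less_one_iff)
  then have "(1 - z / w) * qpoch (r\<^sup>2 * (z / w)) (r\<^sup>2) = qpoch (z / w) (r\<^sup>2)"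
    using qpoch_rec[of "r\<^sup>2" "z / w"] by (simp add: mult.commute)
  then show ?thesis
    using assms by (simp add: theta_def power2_eq_square flip: mult.assoc)
qed

lemma prod_Diff_single:
  fixes f :: "nat \<Rightarrow> complex"
  assumes "i < n"
  shows "(\<Prod>k<n. f k) = f i * (\<Prod>k\<in>{..<n} - {i}. f k)"
  using assms by (intro prod.remove) auto

text \<open>As a polynomial in the variable i alone the product has its zeros at the other
  \<open>u k\<close>. The sign inside \<open>C\<close> depends on whether \<open>k\<close> comes
  before or after \<open>i\<close>.\<close>

lemma vandermonde_update:
  fixes u :: "nat \<Rightarrow> complex"
  assumes i: "i < n" and u: "\<And>k. k < n \<Longrightarrow> k \<noteq> i \<Longrightarrow> u k \<noteq> 0"
  shows "\<exists>C. \<forall>z. (\<Prod>j<n. \<Prod>l<j. (u(i := z)) j - (u(i := z)) l) = C * (\<Prod>k\<in>{..<n} - {i}. 1 - z / u k)"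
proof (intro exI allI)
  define A where "A = (\<lambda>j. \<Prod>l\<in>{..<j} - {i}. u j - u l)"
  define C where "C = (\<Prod>k\<in>{..<n} - {i}. A k) * (\<Prod>k\<in>{..<n} - {i}. if k < i then - u k else u k)"
  fix z
  define e where "e = (\<lambda>k. if k < i then z - u k else u k - z)"
  have row: "(\<Prod>l<j. (u(i := z)) j - (u(i := z)) l) = (if i < j then e j else 1) * A j" if "j \<noteq> i" for j
  proof (cases "i < j")
    case True
    then have "(\<Prod>l<j. (u(i := z)) j - (u(i := z)) l) = (u j - z) * (\<Prod>l\<in>{..<j} - {i}. (u(i := z)) j - (u(i := z)) l)"
      using that by (subst prod_Diff_single[of i j]) auto
    also have "(\<Prod>l\<in>{..<j} - {i}. (u(i := z)) j - (u(i := z)) l) = A j"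
      unfolding A_def using that by (intro prod.cong) auto
    finally show ?thesis using True by (simp add: e_def)
  next
    case False
    then show ?thesis
      unfolding A_def using that by (auto intro!: prod.cong)
  qed
  have col: "(\<Prod>l<i. (u(i := z)) i - (u(i := z)) l) = (\<Prod>k\<in>{..<n} - {i}. if k < i then e k else 1)"
  proof -
    have "{..<i} = {k \<in> {..<n} - {i}. k < i}" using i by auto
    then have "(\<Prod>k\<in>{..<n} - {i}. if k < i then e k else 1) = (\<Prod>l<i. e l)"
      by (simp flip: prod.inter_filter)
    then show ?thesis by (auto simp: e_def intro!: prod.cong)
  qed
  have "(\<Prod>j<n. \<Prod>l<j. (u(i := z)) j - (u(i := z)) l) =
     (\<Prod>l<i. (u(i := z)) i - (u(i := z)) l) * (\<Prod>j\<in>{..<n} - {i}. \<Prod>l<j. (u(i := z)) j - (u(i := z)) l)"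
    by (rule prod_Diff_single[OF i])
  also have "(\<Prod>j\<in>{..<n} - {i}. \<Prod>l<j. (u(i := z)) j - (u(i := z)) l) = (\<Prod>j\<in>{..<n} - {i}. (if i < j then e j else 1) * A j)"
    by (intro prod.cong refl row) auto
  also have "(\<Prod>l<i. (u(i := z)) i - (u(i := z)) l) * \<dots> =
      (\<Prod>k\<in>{..<n} - {i}. A k) * ((\<Prod>k\<in>{..<n} - {i}. if k < i then e k else 1) * (\<Prod>k\<in>{..<n} - {i}. if i < k then e k else 1))"
    unfolding col by (simp add: prod.distrib)
  also have "(\<Prod>k\<in>{..<n} - {i}. if k < i then e k else 1) * (\<Prod>k\<in>{..<n} - {i}. if i < k then e k else 1) =
      (\<Prod>k\<in>{..<n} - {i}. (if k < i then - u k else u k) * (1 - z / u k))"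
    unfolding prod.distrib[symmetric] by (intro prod.cong) (auto simp: e_def field_simps u)
  finally show "(\<Prod>j<n. \<Prod>l<j. (u(i := z)) j - (u(i := z)) l) = C * (\<Prod>k\<in>{..<n} - {i}. 1 - z / u k)"
    by (simp add: C_def prod.distrib)
qed

text \<open>In the variable i the kernel is a constant times n thetas: one with b_k = 1/(r u_k) for
  each other variable, and the leading one with b_i = (-1)^(n-1) times the product of the other
  variables. The product of all b is 1/(-r)^(n-1), as \<open>prod_theta_in_space\<close> requires;
  this explains the sign in the leading theta.\<close>

lemma theta_kernel_in_space:
  assumes r: "r \<noteq> 0" "norm r < 1" and i: "i < n" and u: "\<And>k. k < n \<Longrightarrow> u k \<noteq> 0"
  shows "(\<lambda>z. theta_kernel r n (u(i := z))) \<in> theta_space r n"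
proof -
  define J where "J = {..<n} - {i}"
  define q where "q = r\<^sup>2"
  have n: "n > 0" using i by simp
  have J: "finite J" "card J = n - 1" using i by (auto simp: J_def)
  have "\<exists>C. \<forall>z. (\<Prod>j<n. \<Prod>l<j. (u(i := z)) j - (u(i := z)) l) = C * (\<Prod>k\<in>J. 1 - z / u k)"
    unfolding J_def by (rule vandermonde_update[OF i u])
  then obtain C where C: "\<And>z. (\<Prod>j<n. \<Prod>l<j. (u(i := z)) j - (u(i := z)) l) = C * (\<Prod>k\<in>J. 1 - z / u k)"
    by blast
  define b where "b = (\<lambda>k. if k = i then (-1) ^ (n - 1) * (\<Prod>k\<in>J. u k) else 1 / (r * u k))"
  define D where "D = C * (\<Prod>a\<in>J. \<Prod>b\<in>J. qpoch (q * (u a / u b)) q) * qpoch q q"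
  have "(\<Prod>k<n. b k) = b i * (\<Prod>k\<in>J. 1 / (r * u k))"
    unfolding J_def by (subst prod_Diff_single[OF i]) (auto simp: b_def intro!: prod.cong)
  also have "\<dots> = (-1) ^ (n - 1) / r ^ (n - 1)"
  proof -
    have "(\<Prod>k\<in>J. u k) \<noteq> 0" using u by (auto simp: J_def)
    then show ?thesis
      by (simp add: b_def prod_dividef prod.distrib J)
  qed
  also have "\<dots> = 1 / (- r) ^ (n - 1)"
    by (cases "even (n - 1)") auto
  finally have prod_b: "(- r) ^ n * (\<Prod>k<n. b k) = - r"
    using r n by (simp add: power_eq_if[of _ n])
  have b: "b k \<noteq> 0" if "k < n" for k
    using that u r by (auto simp: b_def J_def)
  have eq: "theta_kernel r n (u(i := z)) = D * (\<Prod>k<n. theta r (b k * z))" if z: "z \<noteq> 0" for z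
  proof -
    define v where "v = u(i := z)"
    have v: "v i = z" "\<And>k. k \<in> J \<Longrightarrow> v k = u k" by (auto simp: v_def J_def)
    have "(\<Prod>k<n. v k) = z * (\<Prod>k\<in>J. u k)"
      unfolding J_def by (subst prod_Diff_single[OF i]) (auto simp: v_def)
    then have t1: "theta r ((-1) ^ (n - 1) * (\<Prod>k<n. v k)) = theta r (b i * z)"
      by (simp add: b_def mult_ac)
    have t2: "(\<Prod>a<n. \<Prod>b<n. qpoch (q * (v a / v b)) q) = qpoch q q * (\<Prod>k\<in>J. qpoch (q * (z / u k)) q)
        * (\<Prod>k\<in>J. qpoch (q * (u k / z)) q) * (\<Prod>a\<in>J. \<Prod>b\<in>J. qpoch (q * (u a / u b)) q)"
    proof -
      have row: "(\<Prod>b<n. qpoch (q * (w / v b)) q) = qpoch (q * (w / z)) q * (\<Prod>b\<in>J. qpoch (q * (w / u b)) q)" for w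
        unfolding J_def by (subst prod_Diff_single[OF i]) (auto simp: v_def)
      have "(\<Prod>a<n. qpoch (q * (v a / z)) q * (\<Prod>b\<in>J. qpoch (q * (v a / u b)) q)) =
          qpoch (q * (z / z)) q * (\<Prod>b\<in>J. qpoch (q * (z / u b)) q) *
          (\<Prod>a\<in>J. qpoch (q * (u a / z)) q * (\<Prod>b\<in>J. qpoch (q * (u a / u b)) q))"
        by (subst prod_Diff_single[OF i]) (simp add: v J_def[symmetric])
      then show ?thesis
        unfolding row using z by (simp add: prod.distrib)
    qed
    have t3: "(\<Prod>k\<in>J. 1 - z / u k) * ((\<Prod>k\<in>J. qpoch (q * (z / u k)) q) * (\<Prod>k\<in>J. qpoch (q * (u k / z)) q)) = (\<Prod>k\<in>J. theta r (b k * z))"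
      unfolding prod.distrib[symmetric]
    proof (intro prod.cong refl)
      fix k assume "k \<in> J"
      then have uk: "u k \<noteq> 0" and "b k = 1 / (r * u k)" using u by (auto simp: J_def b_def)
      then show "(1 - z / u k) * (qpoch (q * (z / u k)) q * qpoch (q * (u k / z)) q) = theta r (b k * z)"
        using theta_factor[OF r z uk] by (simp only: q_def)
    qed
    have "theta_kernel r n v = theta r (b i * z) * (C * (\<Prod>k\<in>J. 1 - z / u k)) * (\<Prod>a<n. \<Prod>b<n. qpoch (q * (v a / v b)) q)"
      unfolding theta_kernel_def t1 using C[of z] by (simp add: v_def q_def)
    also have "\<dots> = D * (theta r (b i * z) * ((\<Prod>k\<in>J. 1 - z / u k) * ((\<Prod>k\<in>J. qpoch (q * (z / u k)) q) * (\<Prod>k\<in>J. qpoch (q * (u k / z)) q))))"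
      unfolding t2 D_def by (simp only: mult_ac)
    also have "\<dots> = D * (\<Prod>k<n. theta r (b k * z))"
      unfolding t3 by (simp add: prod_Diff_single[OF i, of "\<lambda>k. theta r (b k * z)"] J_def)
    finally show ?thesis by (simp add: v_def)
  qed
  have "(\<lambda>z. D * (\<Prod>k<n. theta r (b k * z))) \<in> theta_space r n"
    using r n b prod_b by (intro theta_space_cmult prod_theta_in_space) auto
  then show ?thesis
    unfolding theta_space_def using eq by auto
qed

text \<open>Each term of the permutation sum contains the variable i in a single factor, a basis
  series.\<close>

lemma leibniz_in_theta_space:
  assumes "i < n"
  shows "(\<lambda>z. leibniz n (\<lambda>j k. theta_basis r n j ((u(i := z)) k))) \<in> theta_space r n"
  unfolding leibniz_def
proof (rule theta_space_sum)
  fix p assume p: "p \<in> {p. p permutes {..<n}}"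
  then have "p i < n" using assms permutes_in_image[of p "{..<n}" i] by simp
  then have "(\<lambda>z. (of_int (sign p) * (\<Prod>k\<in>{..<n} - {i}. theta_basis r n (p k) (u k))) * theta_basis r n (p i) z) \<in> theta_space r n"
    by (intro theta_space_cmult theta_basis_in_space)
  then show "(\<lambda>z. of_int (sign p) * (\<Prod>k<n. theta_basis r n (p k) ((u(i := z)) k))) \<in> theta_space r n"
    by (subst prod_Diff_single[OF assms]) (simp add: mult_ac)
qed

text \<open>If two variables agree, both sides vanish. Otherwise the variables run through all n-th
  roots of unity: their product cancels the sign in the leading theta, and for each j the product
  over i equals (q^n;q^n), diagonal factor included. The n-th power of this, times
  \<open>theta r 1\<close>, is the product of the Theta_j(1), which is the constant left by the
  Vandermonde matrix.\<close>

lemma theta_kernel_roots_unity: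
  assumes r: "r \<noteq> 0" "norm r < 1" and n: "n > 0" and u: "\<And>k. k < n \<Longrightarrow> u k ^ n = 1"
  shows "theta_kernel r n u = leibniz n (\<lambda>j k. theta_basis r n j (u k))"
proof -
  define q where "q = r\<^sup>2"
  have q: "norm q < 1" using r by (simp add: q_def norm_power power_less_one_iff)
  define V where "V = (\<Prod>j<n. \<Prod>i<j. u j - u i)"
  have "leibniz n (\<lambda>j k. theta_basis r n j (u k)) = leibniz n (\<lambda>j k. theta_basis r n j 1 * u k ^ j)"
    using theta_basis_root_unity[OF r n u] by (intro leibniz_cong) (simp add: mult.commute)
  also have "\<dots> = qpoch (q ^ n) (q ^ n) ^ n * theta r 1 * V"
    by (simp add: leibniz_scale_row vandermonde_leibniz prod_theta_basis_1[OF r n] V_def q_def)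
  finally have rhs: "leibniz n (\<lambda>j k. theta_basis r n j (u k)) = qpoch (q ^ n) (q ^ n) ^ n * theta r 1 * V" .
  show ?thesis
  proof (cases "V = 0")
    case True
    then show ?thesis unfolding rhs by (simp add: theta_kernel_def V_def)
  next
    case False
    have "inj_on u {..<n}"
    proof (rule linorder_inj_onI')
      fix i j assume "i \<in> {..<n}" "j \<in> {..<n}" "i < j"
      moreover have "\<forall>a<n. \<forall>b<a. u a \<noteq> u b" using False by (simp add: V_def)
      ultimately show "u i \<noteq> u j" by (metis lessThan_iff)
    qed
    moreover have "u ` {..<n} \<subseteq> {\<zeta>. \<zeta> ^ n = 1}" using u by auto
    moreover have "card {\<zeta>::complex. \<zeta> ^ n = 1} = n" "finite {\<zeta>::complex. \<zeta> ^ n = 1}"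
      using n finite_nth_roots[of n 1] by (auto simp: card_roots_unity_eq)
    ultimately have bij: "bij_betw u {..<n} {\<zeta>. \<zeta> ^ n = 1}"
      by (metis bij_betw_def card_image card_lessThan card_subset_eq)
    have "(\<Prod>k<n. u k) = (-1) ^ (n - 1)"
      using prod.reindex_bij_betw[OF bij, of "\<lambda>x. x"] prod_roots_unity[OF n] by simp
    then have "(-1) ^ (n - 1) * (\<Prod>k<n. u k) = 1"
      by (simp flip: power_mult_distrib)
    moreover have "(\<Prod>i<n. qpoch (q * (u i / u j)) q) = qpoch (q ^ n) (q ^ n)" if "j < n" for j
    proof -
      have "u j \<noteq> 0" using u[OF that] n by (auto simp: power_0_left)
      have "(\<Prod>i<n. qpoch (q * (u i / u j)) q) = (\<Prod>i<n. qpoch (q / u j * u i) q)" by simp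
      also have "\<dots> = (\<Prod>\<zeta>\<in>{\<zeta>. \<zeta> ^ n = 1}. qpoch (q / u j * \<zeta>) q)"
        by (rule prod.reindex_bij_betw[OF bij])
      also have "\<dots> = qpoch (q ^ n) (q ^ n)"
        using prod_qpoch_roots_unity[OF q n, of "q / u j"] u[OF that] by (simp add: power_divide)
      finally show ?thesis .
    qed
    ultimately show ?thesis
      unfolding rhs theta_kernel_def q_def[symmetric] V_def[symmetric]
      by (subst prod.swap) (simp add: mult_ac)
  qed
qed

text \<open>Both sides lie in the theta space in each variable separately, so it suffices to compare them
  when all variables are \<open>n\<close>-th roots of unity.\<close>

theorem theta_kernel_leibniz:
  assumes r: "r \<noteq> 0" "norm r < 1" and n: "n > 0" and u: "\<And>k. k < n \<Longrightarrow> u k \<noteq> 0"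
  shows "theta_kernel r n u = leibniz n (\<lambda>j k. theta_basis r n j (u k))"
proof -
  define h where "h = (\<lambda>u. theta_kernel r n u - leibniz n (\<lambda>j k. theta_basis r n j (u k)))"
  have h_space: "(\<lambda>z. h (u(i := z))) \<in> theta_space r n" if "i < n" "\<And>k. k < n \<Longrightarrow> u k \<noteq> 0" for u i
    unfolding h_def
    using theta_space_add[OF theta_kernel_in_space[OF r that]
       theta_space_cmult[OF leibniz_in_theta_space[OF that(1), of r u], of "-1"]] by simp
  \<comment> \<open>Here \<open>m\<close> counts the leading variables that are arbitrary. One more
    is freed because \<open>h\<close> vanishes at every root of unity in it.\<close>
  have "h u = 0" if "m \<le> n" "\<And>k. k < n \<Longrightarrow> u k \<noteq> 0" "\<And>k. m \<le> k \<Longrightarrow> k < n \<Longrightarrow> u k ^ n = 1" for u m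
    using that
  proof (induction m arbitrary: u)
    case 0
    then show ?case using theta_kernel_roots_unity[OF r n, of u] by (simp add: h_def)
  next
    case (Suc m)
    have "h (u(m := u m)) = 0"
    proof (rule theta_space_zero[OF r n h_space])
      fix \<zeta> :: complex assume "\<zeta> ^ n = 1"
      then show "h (u(m := \<zeta>)) = 0"
        using Suc.prems n by (intro Suc.IH) (auto simp: power_0_left)
    qed (use Suc.prems in auto)
    then show ?case by simp
  qed
  from this[of n u] u show ?thesis by (simp add: h_def)
qed

section \<open>Constant terms as torus integrals\<close>

lemma summable_on_norm_bounded:
  fixes c g :: "'a \<Rightarrow> complex"
  assumes "(\<lambda>k. norm (c k)) summable_on A" "\<And>k. k \<in> A \<Longrightarrow> norm (g k) \<le> B"
  shows "(\<lambda>k. norm (c k * g k)) summable_on A"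
proof (rule Infinite_Sum.summable_on_comparison_test)
  show "(\<lambda>k. norm (c k) * B) summable_on A"
    by (intro summable_on_cmult_left assms)
qed (auto simp: norm_mult intro!: mult_left_mono assms)

text \<open>The functions are uniformly bounded, so absolutely summable coefficients dominate;
  \<open>int_decode\<close> reduces the sums over the integers to ordinary series.\<close>

lemma has_bochner_integral_infsum_int:
  fixes c :: "int \<Rightarrow> complex" and f :: "int \<Rightarrow> 'a \<Rightarrow> complex"
  assumes "finite_measure M" and meas: "\<And>k. f k \<in> borel_measurable M"
    and bound: "\<And>k x. x \<in> space M \<Longrightarrow> norm (f k x) \<le> B"
    and c: "(\<lambda>k. norm (c k)) summable_on UNIV"
  shows "has_bochner_integral M (\<lambda>x. \<Sum>\<^sub>\<infinity>k. c k * f k x) (\<Sum>\<^sub>\<infinity>k. c k * (\<integral>x. f k x \<partial>M))"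
proof -
  interpret finite_measure M by fact
  define F where "F = (\<lambda>i x. c (int_decode i) * f (int_decode i) x)"
  have f_int: "integrable M (f k)" for k
    by (rule integrable_const_bound[where B = B]) (auto intro: bound meas)
  then have F_int: "integrable M (F i)" for i
    unfolding F_def by (intro integrable_mult_right)
  have sums_norm: "summable (\<lambda>i. norm (c (int_decode i)))"
    using has_sum_int_imp_sums[OF has_sum_infsum[OF c]] by (rule sums_summable)
  have summ: "summable (\<lambda>i. norm (F i x))" if "x \<in> space M" for x
  proof (rule summable_comparison_test')
    show "summable (\<lambda>i. norm (c (int_decode i)) * B)"
      by (intro summable_mult2 sums_norm)
    show "norm (norm (F i x)) \<le> norm (c (int_decode i)) * B" if "i \<ge> 0" for i
      using bound[OF \<open>x \<in> space M\<close>] by (auto simp: F_def norm_mult intro!: mult_left_mono)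
  qed
  have AE: "AE x in M. summable (\<lambda>i. norm (F i x))"
    using summ by (intro AE_I2)
  have int_bound: "(\<integral>x. norm (f k x) \<partial>M) \<le> B * measure M (space M)" for k
  proof -
    have "(\<integral>x. norm (f k x) \<partial>M) \<le> (\<integral>x. B \<partial>M)"
      by (rule integral_mono) (auto intro: integrable_norm f_int bound)
    then show ?thesis by (simp add: mult.commute)
  qed
  have summ2: "summable (\<lambda>i. \<integral>x. norm (F i x) \<partial>M)"
  proof (rule summable_comparison_test')
    show "summable (\<lambda>i. norm (c (int_decode i)) * (B * measure M (space M)))"
      by (intro summable_mult2 sums_norm)
    show "norm (\<integral>x. norm (F i x) \<partial>M) \<le> norm (c (int_decode i)) * (B * measure M (space M))" if "i \<ge> 0" for i
      using int_bound[of "int_decode i"]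
      by (simp add: F_def norm_mult mult_left_mono)
  qed
  have "(\<Sum>i. F i x) = (\<Sum>\<^sub>\<infinity>k. c k * f k x)" if "x \<in> space M" for x
  proof -
    have "(\<lambda>k. c k * f k x) summable_on UNIV"
      by (rule abs_summable_summable, rule summable_on_norm_bounded[OF c]) (rule bound[OF that])
    from has_sum_int_imp_sums[OF has_sum_infsum[OF this]] show ?thesis
      unfolding F_def by (rule sums_unique[symmetric])
  qed
  then have eq1: "has_bochner_integral M (\<lambda>x. \<Sum>i. F i x) I \<longleftrightarrow> has_bochner_integral M (\<lambda>x. \<Sum>\<^sub>\<infinity>k. c k * f k x) I" for I
    by (intro has_bochner_integral_cong) auto
  have "norm (\<integral>x. f k x \<partial>M) \<le> B * measure M (space M)" for k
    using int_bound[of k] integral_norm_bound[of M "f k"] by linarith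
  then have "(\<lambda>k. c k * (\<integral>x. f k x \<partial>M)) summable_on UNIV"
    by (intro abs_summable_summable[OF summable_on_norm_bounded[OF c]])
  from has_sum_int_imp_sums[OF has_sum_infsum[OF this]]
  have "(\<Sum>i. \<integral>x. F i x \<partial>M) = (\<Sum>\<^sub>\<infinity>k. c k * (\<integral>x. f k x \<partial>M))"
    unfolding F_def using f_int by (simp add: sums_iff)
  then have "has_bochner_integral M (\<lambda>x. \<Sum>i. F i x) (\<Sum>\<^sub>\<infinity>k. c k * (\<integral>x. f k x \<partial>M))"
    using integrable_suminf[OF F_int AE summ2] integral_suminf[OF F_int AE summ2]
    by (simp add: has_bochner_integral_iff)
  then show ?thesis unfolding eq1 .
qed

abbreviation circle_measure :: "real measure" where
  "circle_measure \<equiv> restrict_space lborel {0..1}"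

definition circ :: "real \<Rightarrow> complex" where
  "circ t = exp (2 * pi * \<i> * complex_of_real t)"

lemma norm_circ [simp]: "norm (circ t) = 1"
  by (simp add: circ_def norm_exp_eq_Re)

lemma circ_nonzero [simp]: "circ t \<noteq> 0"
  by (simp add: circ_def)

lemma circ_powi: "circ t powi k = exp (2 * pi * \<i> * of_int k * complex_of_real t)"
  by (simp add: circ_def exp_power_int mult_ac)

lemma circ_measurable [measurable]: "(\<lambda>t. circ t powi k) \<in> borel_measurable circle_measure"
proof -
  have "(\<lambda>t. circ t powi k) \<in> borel_measurable borel"
    unfolding circ_powi by (intro borel_measurable_continuous_onI continuous_intros)
  then show ?thesis by (simp add: measurable_restrict_space1)
qed

lemma prob_space_circle: "prob_space circle_measure"
  by (rule prob_spaceI) (simp add: emeasure_restrict_space space_restrict_space)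

lemma integral_circ_powi: "(\<integral>t. circ t powi k \<partial>circle_measure) = (if k = 0 then 1 else 0)"
proof (cases "k = 0")
  case True
  interpret prob_space circle_measure by (rule prob_space_circle)
  show ?thesis using True prob_space by (simp add: space_restrict_space)
next
  case False
  define a where "a = 2 * pi * \<i> * complex_of_int k"
  have a: "a \<noteq> 0" using False by (simp add: a_def)
  have "(\<integral>t. circ t powi k \<partial>circle_measure) = (\<integral>t. indicator {0..1} t *\<^sub>R exp (a * complex_of_real t) \<partial>lborel)"
    by (subst integral_restrict_space) (simp_all add: circ_powi a_def)
  also have "\<dots> = exp (a * complex_of_real 1) / a - exp (a * complex_of_real 0) / a"
  proof (rule integral_FTC_Icc)
    fix x :: real assume "0 \<le> x" "x \<le> 1"
    have "((\<lambda>z. exp (a * z) / a) has_field_derivative exp (a * complex_of_real x)) (at (complex_of_real x))"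
      using a by (auto intro!: derivative_eq_intros)
    from has_vector_derivative_real_field[OF this]
    show "((\<lambda>x. exp (a * complex_of_real x) / a) has_vector_derivative exp (a * complex_of_real x)) (at x within {0..1})" .
  qed (auto intro!: continuous_intros)
  also have "exp (a * complex_of_real 1) = 1"
    using exp_integer_2pi[of "of_int k"] by (simp add: a_def mult_ac)
  finally show ?thesis using False by simp
qed

lemma integral_laurent_circ:
  assumes c: "(\<lambda>k. norm (c k)) summable_on UNIV"
  shows "has_bochner_integral circle_measure (\<lambda>t. (\<Sum>\<^sub>\<infinity>m. c m * circ t powi m) * circ t powi (- k)) (c k)"
proof -
  interpret prob_space circle_measure by (rule prob_space_circle)
  have fin: "finite_measure circle_measure" by unfold_locales
  have "has_bochner_integral circle_measure (\<lambda>t. \<Sum>\<^sub>\<infinity>m. c m * circ t powi (m - k))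
     (\<Sum>\<^sub>\<infinity>m. c m * (\<integral>t. circ t powi (m - k) \<partial>circle_measure))"
    by (rule has_bochner_integral_infsum_int[OF fin _ _ c, where B = 1])
       (auto simp: norm_power_int)
  also have "(\<Sum>\<^sub>\<infinity>m. c m * (\<integral>t. circ t powi (m - k) \<partial>circle_measure)) = (\<Sum>\<^sub>\<infinity>m\<in>{k}. c k)"
    unfolding integral_circ_powi by (rule infsum_cong_neutral) auto
  also have "(\<lambda>t. \<Sum>\<^sub>\<infinity>m. c m * circ t powi (m - k)) = (\<lambda>t. (\<Sum>\<^sub>\<infinity>m. c m * circ t powi m) * circ t powi (- k))"
    by (simp add: power_int_diff power_int_minus divide_inverse infsum_cmult_left'
          flip: mult.assoc)
  finally show ?thesis by simp
qed

lemma torus_s_circ: "i < N - 1 \<Longrightarrow> torus_s N \<theta> i = circ (\<theta> i)"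
  by (simp add: torus_s_def circ_def)

lemma torus_s_last: "torus_s (Suc M) \<theta> M = inverse (\<Prod>i<M. circ (\<theta> i))"
  by (simp add: torus_s_def circ_def)

lemma prod_powi: "(\<Prod>i\<in>I. f i) powi k = (\<Prod>i\<in>I. (f i :: complex) powi k)"
  by (induction I rule: infinite_finite_induct) (auto simp: power_int_mult_distrib)

lemma norm_torus_s [simp]: "norm (torus_s N \<theta> i) = 1"
  by (auto simp: torus_s_def norm_inverse prod_norm[symmetric] norm_exp_eq_Re)

text \<open>The last coordinate is the inverse of the product of the others, so its k-th power
  contributes the power -k to each of them. Expanding only the last factor leaves a product of
  circle integrals, each extracting the k-th coefficient; this is why all indices agree in the
  result.\<close>

theorem torus_integral_laurent:
  assumes N: "N > 0" and c: "\<And>i. i < N \<Longrightarrow> (\<lambda>k::int. norm (c i k)) summable_on UNIV"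
  shows "has_bochner_integral (PiM {..<N - 1} (\<lambda>_. circle_measure))
     (\<lambda>\<theta>. \<Prod>i<N. \<Sum>\<^sub>\<infinity>k. c i k * torus_s N \<theta> i powi k) (\<Sum>\<^sub>\<infinity>k. \<Prod>i<N. c i k)"
proof -
  obtain M where NM: "N = Suc M" using N by (cases N) auto
  define G where "G = (\<lambda>i t. \<Sum>\<^sub>\<infinity>m. c i m * circ t powi m)"
  interpret circle: prob_space circle_measure by (rule prob_space_circle)
  interpret product_prob_space "\<lambda>_::nat. circle_measure" "{..<M}"
    by unfold_locales
  have fin: "finite_measure (PiM {..<M} (\<lambda>_. circle_measure))"
    by unfold_locales
  have one: "has_bochner_integral circle_measure (\<lambda>t. G i t * circ t powi (- k)) (c i k)" if "i < M" for i k
    unfolding G_def using c[of i] that NM by (intro integral_laurent_circ) auto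
  have bound1: "norm (G i t) \<le> (\<Sum>\<^sub>\<infinity>m. norm (c i m))" if "i < M" for i t
  proof -
    have "(\<lambda>m. norm (c i m * circ t powi m)) summable_on UNIV"
      using c[of i] that NM by (simp add: norm_mult norm_power_int)
    from norm_infsum_bound[OF this] show ?thesis
      unfolding G_def by (simp add: norm_mult norm_power_int)
  qed
  have prod_int: "integrable (PiM {..<M} (\<lambda>_. circle_measure)) (\<lambda>\<theta>. \<Prod>i<M. G i (\<theta> i) * circ (\<theta> i) powi (- k))" for k
    using one by (intro product_integrable_prod) (auto simp: has_bochner_integral_iff)
  have "has_bochner_integral (PiM {..<M} (\<lambda>_. circle_measure))
     (\<lambda>\<theta>. \<Sum>\<^sub>\<infinity>k. c M k * (\<Prod>i<M. G i (\<theta> i) * circ (\<theta> i) powi (- k)))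
     (\<Sum>\<^sub>\<infinity>k. c M k * (\<integral>\<theta>. (\<Prod>i<M. G i (\<theta> i) * circ (\<theta> i) powi (- k)) \<partial>PiM {..<M} (\<lambda>_. circle_measure)))"
  proof (rule has_bochner_integral_infsum_int[OF fin])
    show "(\<lambda>\<theta>. \<Prod>i<M. G i (\<theta> i) * circ (\<theta> i) powi (- k)) \<in> borel_measurable (PiM {..<M} (\<lambda>_. circle_measure))" for k
      using prod_int by (rule borel_measurable_integrable)
    show "norm (\<Prod>i<M. G i (\<theta> i) * circ (\<theta> i) powi (- k)) \<le> (\<Prod>i<M. \<Sum>\<^sub>\<infinity>m. norm (c i m))" for k \<theta>
      unfolding prod_norm[symmetric]
      by (intro prod_mono) (auto simp: norm_mult norm_power_int bound1)
    show "(\<lambda>k. norm (c M k)) summable_on UNIV" using c NM by simp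
  qed
  also have "(\<lambda>k. c M k * (\<integral>\<theta>. (\<Prod>i<M. G i (\<theta> i) * circ (\<theta> i) powi (- k)) \<partial>PiM {..<M} (\<lambda>_. circle_measure)))
      = (\<lambda>k. \<Prod>i<N. c i k)"
  proof
    fix k
    have "(\<integral>\<theta>. (\<Prod>i<M. G i (\<theta> i) * circ (\<theta> i) powi (- k)) \<partial>PiM {..<M} (\<lambda>_. circle_measure)) = (\<Prod>i<M. c i k)"
      using one by (subst product_integral_prod) (auto simp: has_bochner_integral_iff intro!: prod.cong)
    then show "c M k * (\<integral>\<theta>. (\<Prod>i<M. G i (\<theta> i) * circ (\<theta> i) powi (- k)) \<partial>PiM {..<M} (\<lambda>_. circle_measure)) = (\<Prod>i<N. c i k)"
      by (simp add: NM mult.commute)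
  qed
  also have "(\<lambda>\<theta>. \<Sum>\<^sub>\<infinity>k. c M k * (\<Prod>i<M. G i (\<theta> i) * circ (\<theta> i) powi (- k))) =
      (\<lambda>\<theta>. \<Prod>i<N. \<Sum>\<^sub>\<infinity>k. c i k * torus_s N \<theta> i powi k)"
  proof
    fix \<theta> :: "nat \<Rightarrow> real"
    have "c M k * (\<Prod>i<M. G i (\<theta> i) * circ (\<theta> i) powi (- k)) = (\<Prod>i<M. G i (\<theta> i)) * (c M k * torus_s N \<theta> M powi k)" for k
      by (simp add: NM torus_s_last prod.distrib power_int_minus power_int_inverse prod_powi mult_ac flip: prod_inversef)
    then have "(\<Sum>\<^sub>\<infinity>k. c M k * (\<Prod>i<M. G i (\<theta> i) * circ (\<theta> i) powi (- k))) =
       (\<Prod>i<M. G i (\<theta> i)) * (\<Sum>\<^sub>\<infinity>k. c M k * torus_s N \<theta> M powi k)"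
      by (simp only: infsum_cmult_right')
    also have "(\<Prod>i<M. G i (\<theta> i)) = (\<Prod>i<M. \<Sum>\<^sub>\<infinity>k. c i k * torus_s N \<theta> i powi k)"
      by (intro prod.cong) (auto simp: G_def torus_s_circ NM)
    finally show "(\<Sum>\<^sub>\<infinity>k. c M k * (\<Prod>i<M. G i (\<theta> i) * circ (\<theta> i) powi (- k))) =
       (\<Prod>i<N. \<Sum>\<^sub>\<infinity>k. c i k * torus_s N \<theta> i powi k)"
      by (simp add: NM)
  qed
  finally show ?thesis by (simp add: NM)
qed

lemma summable_on_prod_diag:
  fixes c :: "nat \<Rightarrow> int \<Rightarrow> complex"
  assumes N: "N > 0" and c: "\<And>i. i < N \<Longrightarrow> (\<lambda>k. norm (c i k)) summable_on UNIV"
  shows "(\<lambda>k. \<Prod>i<N. c i k) summable_on UNIV"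
proof -
  obtain M where NM: "N = Suc M" using N by (cases N) auto
  have bound: "norm (c i k) \<le> (\<Sum>\<^sub>\<infinity>m. norm (c i m))" if "i < N" for i k
    using finite_sum_le_infsum[OF c[OF that], of "{k}"] by simp
  have "(\<lambda>k. c M k * (\<Prod>i<M. c i k)) summable_on UNIV"
  proof (rule abs_summable_summable[OF summable_on_norm_bounded])
    show "(\<lambda>k. norm (c M k)) summable_on UNIV" using c NM by simp
    show "norm (\<Prod>i<M. c i k) \<le> (\<Prod>i<M. \<Sum>\<^sub>\<infinity>m. norm (c i m))" for k
      unfolding prod_norm[symmetric] by (intro prod_mono) (auto simp: bound NM)
  qed
  then show ?thesis by (simp add: NM mult.commute)
qed

section \<open>Laurent coefficients of the theta determinant\<close>

text \<open>Extension by zero indexes all Theta_j by the same set of integers, as is needed once the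
  torus integral forces a common exponent.\<close>

definition basis_coeff :: "complex \<Rightarrow> nat \<Rightarrow> nat \<Rightarrow> int \<Rightarrow> complex" where
  "basis_coeff r n j p = (if p mod int n = int j then theta_coeff r n p else 0)"

lemma basis_coeff_has_sum:
  assumes r: "r \<noteq> 0" "norm r < 1" and j: "j < n" and z: "z \<noteq> 0"
  shows "((\<lambda>p. basis_coeff r n j p * z powi p) has_sum theta_basis r n j z) UNIV"
proof -
  have n: "n > 0" using j by simp
  have "bij_betw (\<lambda>m. int j + int n * m) UNIV {p. p mod int n = int j}"
  proof (rule bij_betwI[where g = "\<lambda>p. p div int n"])
    fix p assume "p \<in> {p. p mod int n = int j}"
    then show "int j + int n * (p div int n) = p"
      using mod_mult_div_eq[of p "int n"] by simp
  qed (use j in auto)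
  then have "((\<lambda>p. theta_coeff r n p * z powi p) has_sum theta_basis r n j z) {p. p mod int n = int j}"
    using theta_basis_has_sum[OF r n z, of j] by (subst has_sum_reindex_bij_betw[symmetric])
  then show ?thesis
    by (rule has_sum_cong_neutral[THEN iffD1, rotated -1]) (auto simp: basis_coeff_def)
qed

lemma basis_coeff_summable:
  assumes "r \<noteq> 0" "norm r < 1" "j < n" "z \<noteq> 0"
  shows "(\<lambda>p. norm (basis_coeff r n j p * z powi p)) summable_on UNIV"
  using has_sum_imp_summable[OF basis_coeff_has_sum[OF assms]]
  by (simp only: summable_on_iff_abs_summable_on_complex)

text \<open>The Laurent coefficient of the monomial with exponents \<open>e i\<close> in the
  determinant of the Theta_j(u_i). When the exponents have distinct residues mod n, exactly one
  permutation contributes.\<close>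

definition alt_coeff :: "complex \<Rightarrow> nat \<Rightarrow> (nat \<Rightarrow> int) \<Rightarrow> complex" where
  "alt_coeff r n e = leibniz n (\<lambda>j i. basis_coeff r n j (e i))"

lemma alt_coeff_cong:
  "(\<And>i. i < n \<Longrightarrow> e i = e' i) \<Longrightarrow> alt_coeff r n e = alt_coeff r n e'"
  unfolding alt_coeff_def by (rule leibniz_cong) simp

lemma alt_coeff_permute:
  "\<pi> permutes {..<n} \<Longrightarrow> alt_coeff r n (\<lambda>i. e (\<pi> i)) = of_int (sign \<pi>) * alt_coeff r n e"
  unfolding alt_coeff_def by (rule leibniz_permute)

text \<open>The shift preserves residues mod n, and the factor from \<open>theta_coeff_shift\<close>
  depends only on \<open>e i\<close>, so column i is multiplied by a constant.\<close>

lemma alt_coeff_shift: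
  assumes "r \<noteq> 0" "i < n"
  shows "alt_coeff r n (e(i := e i + int n * b)) =
    alt_coeff r n e * ((-1) powi b * r powi (int n * b * b + (2 * e i + 1 - int n) * b))"
proof -
  define f where "f = (-1) powi b * r powi (int n * b * b + (2 * e i + 1 - int n) * b)"
  have sh: "theta_coeff r n (e i + int n * b) = theta_coeff r n (e i) * f"
    using assms theta_coeff_shift[of r n "e i" b] by (simp only: f_def mult.assoc) simp
  have "alt_coeff r n (e(i := e i + int n * b)) = leibniz n (\<lambda>j k. (if k = i then f else 1) * basis_coeff r n j (e k))"
    unfolding alt_coeff_def using assms
    by (intro leibniz_cong) (auto simp: basis_coeff_def sh mult.commute[of f])
  also have "\<dots> = f * alt_coeff r n e"
    using assms by (simp add: leibniz_scale alt_coeff_def)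
  finally show ?thesis by (simp add: f_def mult.commute)
qed

text \<open>A shift by a multiple of n reduces congruent exponents to equal ones, hence to two equal
  columns.\<close>

lemma alt_coeff_eq_0:
  assumes "r \<noteq> 0" "a < n" "b < n" "a \<noteq> b" "e a mod int n = e b mod int n"
  shows "alt_coeff r n e = 0"
proof -
  obtain k where k: "e b = e a + int n * k"
    using assms(5) by (metis mod_eqE add_diff_cancel_left' diff_add_cancel mult.commute)
  define e' where "e' = e(b := e a)"
  have "alt_coeff r n e' = 0"
    unfolding alt_coeff_def using assms by (intro leibniz_eq_0[of a n b]) (auto simp: e'_def)
  moreover have "e = e'(b := e' b + int n * k)"
    using assms k by (auto simp: e'_def fun_eq_iff)
  ultimately show ?thesis
    using alt_coeff_shift[OF assms(1,3), of e' k] by simp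
qed

lemma alt_coeff_initial: "alt_coeff r n int = 1"
proof -
  have "alt_coeff r n int = Determinant.det (1\<^sub>m n :: complex mat)"
    unfolding alt_coeff_def leibniz_det
    by (intro arg_cong[where f = Determinant.det] eq_matI) (auto simp: basis_coeff_def theta_coeff_base)
  then show ?thesis by simp
qed

text \<open>Raising k by one costs (-1)^N for the cycle and -r^(2k+1) for moving the lowest exponent
  up by N+1. The odd numbers 2k+1 add up to a square.\<close>

lemma alt_coeff_consecutive:
  assumes r: "r \<noteq> 0"
  shows "alt_coeff r (Suc N) (\<lambda>i. k + int i) = ((-1) ^ Suc N) powi k * r powi (k * k)"
proof -
  define A where "A = (\<lambda>k. alt_coeff r (Suc N) (\<lambda>i. k + int i))"
  have step: "A (k + 1) = (-1) ^ Suc N * r powi (2 * k + 1) * A k" for k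
  proof -
    define e where "e = (\<lambda>i. k + int (cycle_up N i))"
    have "A (k + 1) = alt_coeff r (Suc N) (e(N := e N + int (Suc N) * 1))"
      unfolding A_def by (rule alt_coeff_cong) (auto simp: e_def cycle_up_def)
    also have "\<dots> = alt_coeff r (Suc N) e * ((-1) powi 1 * r powi (int (Suc N) * 1 * 1 + (2 * e N + 1 - int (Suc N)) * 1))"
      by (rule alt_coeff_shift) (use r in auto)
    also have "int (Suc N) * 1 * 1 + (2 * e N + 1 - int (Suc N)) * 1 = 2 * k + 1"
      by (simp add: e_def cycle_up_def)
    also have "alt_coeff r (Suc N) e = (-1) ^ N * A k"
      unfolding e_def A_def
      using alt_coeff_permute[OF cycle_up_permutes, where e = "\<lambda>i. k + int i" and r = r] by (simp add: sign_cycle_up)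
    finally show ?thesis by simp
  qed
  have "A k = ((-1) ^ Suc N) powi k * r powi (k * k)"
  proof (induction k rule: int_induct[where k = 0])
    case base
    show ?case using alt_coeff_initial[of r "Suc N"] by (simp add: A_def)
  next
    case (step1 i)
    have "r powi ((i + 1) * (i + 1)) = r powi (2 * i + 1) * r powi (i * i)"
      using r by (simp add: algebra_simps flip: power_int_add)
    then show ?case
      unfolding step step1 by (simp add: power_int_add)
  next
    case (step2 i)
    have "A i = (-1) ^ Suc N * r powi (2 * (i - 1) + 1) * A (i - 1)"
      using step[of "i - 1"] by simp
    then have "A (i - 1) = (-1) ^ Suc N * (A i / r powi (2 * (i - 1) + 1))"
      using r by (cases "even N") auto
    also have "\<dots> = ((-1) ^ Suc N * ((-1) ^ Suc N) powi i) * (r powi (i * i) / r powi (2 * (i - 1) + 1))"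
      by (simp add: step2)
    also have "r powi (i * i) / r powi (2 * (i - 1) + 1) = r powi ((i - 1) * (i - 1))"
      using r by (simp add: algebra_simps flip: power_int_diff)
    also have "(-1) ^ Suc N * ((-1) ^ Suc N) powi i = (((-1) ^ Suc N) powi (i - 1) :: complex)"
      by (cases "even N") (simp_all add: power_int_diff)
    finally show ?case .
  qed
  then show ?thesis by (simp add: A_def)
qed

lemma torus_s_nonzero [simp]: "torus_s N \<theta> i \<noteq> 0"
  using norm_torus_s[of N \<theta> i] by (metis norm_zero zero_neq_one)

text \<open>Here k is the total exponent of s: the theta series contributes k - e, the monomial in
  front contributes e.\<close>

lemma basis_coeff_twist:
  assumes r: "r \<noteq> 0" "norm r < 1" and j: "j < n" and y: "y \<noteq> 0"
  shows "(\<lambda>k. norm (basis_coeff r n j (k - e) * y powi (k - e))) summable_on UNIV"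
    and "s \<noteq> 0 \<Longrightarrow> (\<Sum>\<^sub>\<infinity>k. basis_coeff r n j (k - e) * y powi (k - e) * s powi k) = theta_basis r n j (y * s) * s powi e"
proof -
  have bij: "bij_betw (\<lambda>k. k - e) UNIV UNIV"
    by (rule bij_betwI[where g = "\<lambda>k. k + e"]) auto
  show "(\<lambda>k. norm (basis_coeff r n j (k - e) * y powi (k - e))) summable_on UNIV"
    using basis_coeff_summable[OF r j y] summable_on_reindex_bij_betw[OF bij, of "\<lambda>p. norm (basis_coeff r n j p * y powi p)"]
    by simp
  assume s: "s \<noteq> 0"
  have "((\<lambda>k. basis_coeff r n j (k - e) * (y * s) powi (k - e)) has_sum theta_basis r n j (y * s)) UNIV"
    using basis_coeff_has_sum[OF r j, of "y * s"] y s
      has_sum_reindex_bij_betw[OF bij, of "\<lambda>p. basis_coeff r n j p * (y * s) powi p" "theta_basis r n j (y * s)"]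
    by simp
  from has_sum_cmult_left[OF this, of "s powi e"]
  have "((\<lambda>k. basis_coeff r n j (k - e) * y powi (k - e) * s powi k) has_sum (theta_basis r n j (y * s) * s powi e)) UNIV"
    using s by (simp add: power_int_mult_distrib power_int_diff mult_ac)
  then show "(\<Sum>\<^sub>\<infinity>k. basis_coeff r n j (k - e) * y powi (k - e) * s powi k) = theta_basis r n j (y * s) * s powi e"
    by (rule infsumI)
qed

section \<open>Moments of the theta determinant over the torus\<close>

definition theta_vars :: "nat \<Rightarrow> complex \<Rightarrow> complex \<Rightarrow> (nat \<Rightarrow> real) \<Rightarrow> nat \<Rightarrow> complex" where
  "theta_vars N y z \<theta> i = (if i < N then y * torus_s N \<theta> i else z)"

definition theta_det :: "nat \<Rightarrow> complex \<Rightarrow> complex \<Rightarrow> complex \<Rightarrow> (nat \<Rightarrow> real) \<Rightarrow> complex" where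
  "theta_det N r y z \<theta> = leibniz (Suc N) (\<lambda>j i. theta_basis r (Suc N) j (theta_vars N y z \<theta> i))"

abbreviation torus_measure :: "nat \<Rightarrow> (nat \<Rightarrow> real) measure" where
  "torus_measure N \<equiv> PiM {..<N - 1} (\<lambda>_. circle_measure)"

definition theta_moment :: "nat \<Rightarrow> complex \<Rightarrow> complex \<Rightarrow> complex \<Rightarrow> (nat \<Rightarrow> int) \<Rightarrow> complex" where
  "theta_moment N r y z e =
     (LINT \<theta>|torus_measure N. theta_det N r y z \<theta> * (\<Prod>i<N. torus_s N \<theta> i powi e i))"

lemma prod_theta_moment:
  fixes e :: "nat \<Rightarrow> int"
  assumes N: "N > 0" and r: "r \<noteq> 0" "norm r < 1" and y: "y \<noteq> 0" and p: "\<And>i. i < N \<Longrightarrow> p i < n"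
  defines "S \<equiv> \<Sum>\<^sub>\<infinity>k. \<Prod>i<N. basis_coeff r n (p i) (k - e i) * y powi (k - e i)"
  shows "has_bochner_integral (torus_measure N)
      (\<lambda>\<theta>. \<Prod>i<N. theta_basis r n (p i) (y * torus_s N \<theta> i) * torus_s N \<theta> i powi e i) S"
    and "((\<lambda>k. \<Prod>i<N. basis_coeff r n (p i) (k - e i) * y powi (k - e i)) has_sum S) UNIV"
proof -
  define c where "c = (\<lambda>i k. basis_coeff r n (p i) (k - e i) * y powi (k - e i))"
  have c: "(\<lambda>k. norm (c i k)) summable_on UNIV" if "i < N" for i
    unfolding c_def by (rule basis_coeff_twist(1)[OF r p[OF that] y])
  show "((\<lambda>k. \<Prod>i<N. basis_coeff r n (p i) (k - e i) * y powi (k - e i)) has_sum S) UNIV"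
    unfolding S_def using summable_on_prod_diag[OF N c] by (simp add: c_def)
  have "(\<lambda>\<theta>. \<Prod>i<N. \<Sum>\<^sub>\<infinity>k. c i k * torus_s N \<theta> i powi k) =
     (\<lambda>\<theta>. \<Prod>i<N. theta_basis r n (p i) (y * torus_s N \<theta> i) * torus_s N \<theta> i powi e i)"
    unfolding c_def by (intro ext prod.cong refl basis_coeff_twist(2)[OF r p y]) auto
  moreover have "has_bochner_integral (torus_measure N) (\<lambda>\<theta>. \<Prod>i<N. \<Sum>\<^sub>\<infinity>k. c i k * torus_s N \<theta> i powi k) S"
  proof -
    have "S = (\<Sum>\<^sub>\<infinity>k. \<Prod>i<N. c i k)" by (simp add: S_def c_def)
    then show ?thesis using torus_integral_laurent[where c = c, OF N c] by simp
  qed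
  ultimately show "has_bochner_integral (torus_measure N)
      (\<lambda>\<theta>. \<Prod>i<N. theta_basis r n (p i) (y * torus_s N \<theta> i) * torus_s N \<theta> i powi e i) S"
    by simp
qed

lemma has_sum_finite_sum:
  fixes f :: "'b \<Rightarrow> 'a \<Rightarrow> complex"
  assumes "\<And>i. i \<in> I \<Longrightarrow> (f i has_sum S i) A"
  shows "((\<lambda>x. \<Sum>i\<in>I. f i x) has_sum (\<Sum>i\<in>I. S i)) A"
  using assms by (induction I rule: infinite_finite_induct) (auto intro: has_sum_add)

text \<open>Integration forces one common total exponent k on all torus variables, so u_i enters
  with exponent k - e_i for i < N. The variable z is not integrated and keeps its own exponent b;
  hence a sum over two integers.\<close>

lemma theta_moment_expansion:
  assumes N: "N > 0" and r: "r \<noteq> 0" "norm r < 1" and y: "y \<noteq> 0" and z: "z \<noteq> 0"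
  shows "integrable (torus_measure N) (\<lambda>\<theta>. theta_det N r y z \<theta> * (\<Prod>i<N. torus_s N \<theta> i powi e i))"
    and "((\<lambda>(k, b). alt_coeff r (Suc N) (\<lambda>i. if i < N then k - e i else b) * ((\<Prod>i<N. y powi (k - e i)) * z powi b))
          has_sum theta_moment N r y z e) (UNIV \<times> UNIV)"
proof -
  define n where "n = Suc N"
  define PP where "PP = {p. p permutes {..<n}}"
  have p_less: "p i < n" if "p \<in> PP" "i < n" for p i
    using that permutes_in_image[of p "{..<n}" i] by (simp add: PP_def)
  define S where "S = (\<lambda>p. \<Sum>\<^sub>\<infinity>k. \<Prod>i<N. basis_coeff r n (p i) (k - e i) * y powi (k - e i))"
  define J where "J = (\<Sum>p\<in>PP. of_int (sign p) * (S p * theta_basis r n (p N) z))"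
  have S: "has_bochner_integral (torus_measure N)
      (\<lambda>\<theta>. \<Prod>i<N. theta_basis r n (p i) (y * torus_s N \<theta> i) * torus_s N \<theta> i powi e i) (S p)"
    "((\<lambda>k. \<Prod>i<N. basis_coeff r n (p i) (k - e i) * y powi (k - e i)) has_sum S p) UNIV" if "p \<in> PP" for p
    unfolding S_def by (rule prod_theta_moment[OF N r y]; use p_less[OF that] in \<open>simp add: n_def\<close>)+
  have "has_bochner_integral (torus_measure N)
      (\<lambda>\<theta>. \<Sum>p\<in>PP. of_int (sign p) * ((\<Prod>i<N. theta_basis r n (p i) (y * torus_s N \<theta> i) * torus_s N \<theta> i powi e i) * theta_basis r n (p N) z)) J"
    unfolding J_def by (intro has_bochner_integral_sum has_bochner_integral_mult_right has_bochner_integral_mult_left S)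
  also have "(\<lambda>\<theta>. \<Sum>p\<in>PP. of_int (sign p) * ((\<Prod>i<N. theta_basis r n (p i) (y * torus_s N \<theta> i) * torus_s N \<theta> i powi e i) * theta_basis r n (p N) z))
     = (\<lambda>\<theta>. theta_det N r y z \<theta> * (\<Prod>i<N. torus_s N \<theta> i powi e i))"
    by (simp add: theta_det_def leibniz_def theta_vars_def n_def PP_def prod.distrib sum_distrib_left sum_distrib_right mult_ac)
  finally have *: "has_bochner_integral (torus_measure N) (\<lambda>\<theta>. theta_det N r y z \<theta> * (\<Prod>i<N. torus_s N \<theta> i powi e i)) J" .
  then show "integrable (torus_measure N) (\<lambda>\<theta>. theta_det N r y z \<theta> * (\<Prod>i<N. torus_s N \<theta> i powi e i))"
    by (simp add: has_bochner_integral_iff)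
  have J: "theta_moment N r y z e = J"
    using * by (simp add: theta_moment_def has_bochner_integral_iff)
  have "((\<lambda>x. \<Sum>p\<in>PP. of_int (sign p) * (case x of (k, b) \<Rightarrow>
        (\<Prod>i<N. basis_coeff r n (p i) (k - e i) * y powi (k - e i)) * (basis_coeff r n (p N) b * z powi b)))
     has_sum J) (UNIV \<times> UNIV)"
    unfolding J_def
  proof (intro has_sum_finite_sum has_sum_cmult_right)
    fix p assume p: "p \<in> PP"
    show "((\<lambda>x. case x of (k, b) \<Rightarrow>
        (\<Prod>i<N. basis_coeff r n (p i) (k - e i) * y powi (k - e i)) * (basis_coeff r n (p N) b * z powi b))
        has_sum (S p * theta_basis r n (p N) z)) (UNIV \<times> UNIV)"
      using p_less[OF p, of N]
      by (intro has_sum_product_complex S(2)[OF p] basis_coeff_has_sum[OF r _ z]) (simp add: n_def)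
  qed
  also have "(\<lambda>x. \<Sum>p\<in>PP. of_int (sign p) * (case x of (k, b) \<Rightarrow>
        (\<Prod>i<N. basis_coeff r n (p i) (k - e i) * y powi (k - e i)) * (basis_coeff r n (p N) b * z powi b)))
     = (\<lambda>(k, b). alt_coeff r (Suc N) (\<lambda>i. if i < N then k - e i else b) * ((\<Prod>i<N. y powi (k - e i)) * z powi b))"
    by (simp add: fun_eq_iff alt_coeff_def leibniz_def n_def PP_def prod.distrib sum_distrib_left sum_distrib_right mult_ac)
  finally show "((\<lambda>(k, b). alt_coeff r (Suc N) (\<lambda>i. if i < N then k - e i else b) * ((\<Prod>i<N. y powi (k - e i)) * z powi b))
          has_sum theta_moment N r y z e) (UNIV \<times> UNIV)"
    unfolding J .
qed

text \<open>A permutation moving the last torus coordinate does not permute the integrated angles,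
  so the symmetry is read off the double series: \<open>alt_coeff\<close> is alternating in its
  first N entries, and the powers of y are symmetric.\<close>

lemma theta_moment_permute:
  assumes N: "N > 0" and r: "r \<noteq> 0" "norm r < 1" and y: "y \<noteq> 0" and z: "z \<noteq> 0"
    and \<tau>: "\<tau> permutes {..<N}"
  shows "theta_moment N r y z (\<lambda>i. e (\<tau> i)) = of_int (sign \<tau>) * theta_moment N r y z e"
proof (rule has_sum_unique)
  show "((\<lambda>(k, b). alt_coeff r (Suc N) (\<lambda>i. if i < N then k - e (\<tau> i) else b) * ((\<Prod>i<N. y powi (k - e (\<tau> i))) * z powi b))
          has_sum theta_moment N r y z (\<lambda>i. e (\<tau> i))) (UNIV \<times> UNIV)"
    by (rule theta_moment_expansion(2)[OF N r y z])
  have \<tau>': "\<tau> permutes {..<Suc N}"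
    using \<tau> by (rule permutes_subset) auto
  have "alt_coeff r (Suc N) (\<lambda>i. if i < N then k - e (\<tau> i) else b) =
     of_int (sign \<tau>) * alt_coeff r (Suc N) (\<lambda>i. if i < N then k - e i else b)" for k b
  proof -
    have "\<tau> i < N \<longleftrightarrow> i < N" for i
      using permutes_in_image[OF \<tau>, of i] by simp
    then show ?thesis
      using alt_coeff_permute[OF \<tau>', where r = r and e = "\<lambda>i. if i < N then k - e i else b"] by simp
  qed
  moreover have "(\<Prod>i<N. y powi (k - e (\<tau> i))) = (\<Prod>i<N. y powi (k - e i))" for k
    using prod.permute[OF \<tau>, of "\<lambda>i. y powi (k - e i)"] by (simp add: o_def)
  moreover have "((\<lambda>x. of_int (sign \<tau>) * (case x of (k, b) \<Rightarrow> alt_coeff r (Suc N) (\<lambda>i. if i < N then k - e i else b) * ((\<Prod>i<N. y powi (k - e i)) * z powi b)))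
          has_sum of_int (sign \<tau>) * theta_moment N r y z e) (UNIV \<times> UNIV)"
    by (intro has_sum_cmult_right theta_moment_expansion(2)[OF N r y z])
  ultimately show "((\<lambda>(k, b). alt_coeff r (Suc N) (\<lambda>i. if i < N then k - e (\<tau> i) else b) * ((\<Prod>i<N. y powi (k - e (\<tau> i))) * z powi b))
          has_sum of_int (sign \<tau>) * theta_moment N r y z e) (UNIV \<times> UNIV)"
    by (simp add: case_prod_unfold mult_ac)
qed

text \<open>Each permutation in the expansion of the second Vandermonde factor contributes equally.\<close>

lemma integral_theta_det_vandermonde:
  assumes N: "N > 0" and r: "r \<noteq> 0" "norm r < 1" and y: "y \<noteq> 0" and z: "z \<noteq> 0"
  shows "(LINT \<theta>|torus_measure N. theta_det N r y z \<theta>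
       * (\<Prod>j<N. \<Prod>i<j. inverse (torus_s N \<theta> j) - inverse (torus_s N \<theta> i))
       * (\<Sum>l<N. torus_s N \<theta> l powi m)) =
     fact N * (\<Sum>l<N. theta_moment N r y z (\<lambda>i. - int i + (if i = l then m else 0)))"
proof -
  \<comment> \<open>The exponents of the identity term of the Vandermonde product in 1/s, with s_l^m
    inserted. The term of a permutation \<tau> has exponents \<open>E (\<tau> l) (\<tau> i)\<close>,
    so it is a permuted copy.\<close>
  define E where "E = (\<lambda>l i. - int i + (if i = l then m else 0))"
  define PP where "PP = {\<tau>. \<tau> permutes {..<N}}"
  have card: "finite PP" "card PP = fact N"
    by (auto simp: PP_def finite_permutations card_permutations)
  have exp_eq: "(\<Prod>j<N. \<Prod>i<j. inverse (s j) - inverse (s i)) * (\<Sum>l<N. s l powi m) =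
     (\<Sum>\<tau>\<in>PP. of_int (sign \<tau>) * (\<Sum>l<N. \<Prod>i<N. s i powi (E (\<tau> l) (\<tau> i))))" if s: "\<And>i. s i \<noteq> 0" for s :: "nat \<Rightarrow> complex"
  proof -
    have "(\<Prod>j<N. \<Prod>i<j. inverse (s j) - inverse (s i)) = leibniz N (\<lambda>j i. inverse (s i) ^ j)"
      by (rule vandermonde_leibniz[symmetric])
    also have "\<dots> = (\<Sum>\<tau>\<in>PP. of_int (sign \<tau>) * (\<Prod>i<N. s i powi (- int (\<tau> i))))"
      by (simp add: leibniz_def PP_def power_int_minus power_inverse)
    finally have "(\<Prod>j<N. \<Prod>i<j. inverse (s j) - inverse (s i)) * (\<Sum>l<N. s l powi m) =
      (\<Sum>\<tau>\<in>PP. of_int (sign \<tau>) * (\<Sum>l<N. (\<Prod>i<N. s i powi (- int (\<tau> i))) * s l powi m))"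
      by (simp add: sum_distrib_left sum_distrib_right mult_ac)
    also have "\<dots> = (\<Sum>\<tau>\<in>PP. of_int (sign \<tau>) * (\<Sum>l<N. \<Prod>i<N. s i powi (E (\<tau> l) (\<tau> i))))"
    proof (intro sum.cong refl arg_cong2[where f = "(*)"])
      fix \<tau> l assume \<tau>: "\<tau> \<in> PP" and l: "l \<in> {..<N}"
      have inj: "\<tau> i = \<tau> l \<longleftrightarrow> i = l" for i
        using \<tau> by (auto simp: PP_def dest: permutes_inj[THEN injD])
      have "(\<Prod>i<N. s i powi (E (\<tau> l) (\<tau> i))) = (\<Prod>i<N. s i powi (- int (\<tau> i)) * (if i = l then s i powi m else 1))"
        by (intro prod.cong) (auto simp: E_def inj power_int_diff power_int_minus divide_inverse s)
      also have "\<dots> = (\<Prod>i<N. s i powi (- int (\<tau> i))) * s l powi m"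
        using l by (simp add: prod.distrib)
      finally show "(\<Prod>i<N. s i powi (- int (\<tau> i))) * s l powi m = (\<Prod>i<N. s i powi (E (\<tau> l) (\<tau> i)))" ..
    qed
    finally show ?thesis .
  qed
  have int: "integrable (torus_measure N) (\<lambda>\<theta>. theta_det N r y z \<theta> * (\<Prod>i<N. torus_s N \<theta> i powi e i))" for e
    by (rule theta_moment_expansion(1)[OF N r y z])
  have "(LINT \<theta>|torus_measure N. theta_det N r y z \<theta>
       * (\<Prod>j<N. \<Prod>i<j. inverse (torus_s N \<theta> j) - inverse (torus_s N \<theta> i)) * (\<Sum>l<N. torus_s N \<theta> l powi m)) =
     (LINT \<theta>|torus_measure N. (\<Sum>\<tau>\<in>PP. of_int (sign \<tau>) * (\<Sum>l<N. theta_det N r y z \<theta> * (\<Prod>i<N. torus_s N \<theta> i powi (E (\<tau> l) (\<tau> i))))))"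
    unfolding mult.assoc exp_eq[OF torus_s_nonzero] by (simp add: sum_distrib_left mult_ac)
  also have "\<dots> = (\<Sum>\<tau>\<in>PP. of_int (sign \<tau>) * (\<Sum>l<N. theta_moment N r y z (\<lambda>i. E (\<tau> l) (\<tau> i))))"
    unfolding theta_moment_def using int by simp
  also have "\<dots> = (\<Sum>\<tau>\<in>PP. \<Sum>l<N. theta_moment N r y z (E l))"
  proof (rule sum.cong[OF refl])
    fix \<tau> assume "\<tau> \<in> PP"
    then have \<tau>: "\<tau> permutes {..<N}" by (simp add: PP_def)
    \<comment> \<open>One sign comes from the Vandermonde term and one from permuting the moment, so
      they cancel; the sum over l absorbs the relabelling of the insertion.\<close>
    have sg: "of_int (sign \<tau>) * of_int (sign \<tau>) = (1 :: complex)"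
      by (simp flip: of_int_mult)
    have "of_int (sign \<tau>) * (\<Sum>l<N. theta_moment N r y z (\<lambda>i. E (\<tau> l) (\<tau> i))) = (\<Sum>l<N. theta_moment N r y z (E (\<tau> l)))"
      unfolding theta_moment_permute[OF N r y z \<tau>] sum_distrib_left mult.assoc[symmetric] sg by simp
    also have "\<dots> = (\<Sum>l<N. theta_moment N r y z (E l))"
      using sum.permute[OF \<tau>, of "\<lambda>l. theta_moment N r y z (E l)"] by (simp add: o_def)
    finally show "of_int (sign \<tau>) * (\<Sum>l<N. theta_moment N r y z (\<lambda>i. E (\<tau> l) (\<tau> i))) = (\<Sum>l<N. theta_moment N r y z (E l))" .
  qed
  also have "\<dots> = fact N * (\<Sum>l<N. theta_moment N r y z (E l))"
    by (simp add: card)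
  finally show ?thesis unfolding E_def .
qed

section \<open>Factorization of the integrand through the theta determinant\<close>

lemma prod_torus_s:
  assumes "N > 0"
  shows "(\<Prod>i<N. torus_s N \<theta> i) = 1"
proof -
  obtain M where "N = Suc M" using assms by (cases N) auto
  then show ?thesis
    using torus_s_circ[of _ N \<theta>] by (simp add: torus_s_last)
qed

lemma prod_off_diagonal:
  fixes f :: "nat \<Rightarrow> nat \<Rightarrow> complex"
  shows "(\<Prod>i<N. \<Prod>j<N. if i \<noteq> j then f i j else 1) = (\<Prod>j<N. \<Prod>i<j. f i j * f j i)"
proof (induction N)
  case (Suc N)
  have "(\<Prod>i<Suc N. \<Prod>j<Suc N. if i \<noteq> j then f i j else 1) =
     (\<Prod>i<N. (\<Prod>j<N. if i \<noteq> j then f i j else 1) * f i N) * (\<Prod>j<N. f N j)"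
    by (simp add: prod.distrib)
  then show ?case using Suc by (simp add: prod.distrib mult_ac)
qed simp

lemma prod_diagonal:
  fixes f :: "nat \<Rightarrow> nat \<Rightarrow> complex"
  shows "(\<Prod>i<N. \<Prod>j<N. f i j) = (\<Prod>i<N. f i i) * (\<Prod>i<N. \<Prod>j<N. if i \<noteq> j then f i j else 1)"
  unfolding prod.distrib[symmetric]
proof (rule prod.cong[OF refl])
  fix i assume "i \<in> {..<N}"
  then have i: "i < N" by simp
  show "(\<Prod>j<N. f i j) = f i i * (\<Prod>j<N. if i \<noteq> j then f i j else 1)"
    unfolding prod_Diff_single[OF i] by (auto intro!: prod.cong)
qed

text \<open>The factors of the kernel that couple \<open>z\<close> to \<open>y s_i\<close> produce the matter factors of the integrand.
  The constraint on \<open>z\<close> fixes the leading theta factor of the kernel to the nonzero value \<open>theta r 1\<close>.\<close>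

lemma su_integrand_factor:
  assumes r: "r \<noteq> 0" "norm r < 1" and x: "x \<noteq> 0" and N: "N > 0" and z: "z \<noteq> 0" "(r * x * z) ^ N * z = (-1) ^ N"
  defines "q \<equiv> r\<^sup>2" and "y \<equiv> r * x * z"
  shows "theta r 1 * z ^ N * (\<Prod>j<N. y ^ j) * qpoch q q ^ Suc N * su_integrand m N q r x \<theta> =
     theta_det N r y z \<theta> * (\<Prod>j<N. \<Prod>i<j. inverse (torus_s N \<theta> j) - inverse (torus_s N \<theta> i))
       * (\<Sum>l<N. torus_s N \<theta> l powi m)"
proof -
  define s where "s = torus_s N \<theta>"
  define u where "u = theta_vars N y z \<theta>"
  have q: "norm q < 1" using r by (simp add: q_def norm_power power_less_one_iff)
  have s: "s i \<noteq> 0" for i by (simp add: s_def)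
  have y: "y \<noteq> 0" using r x z by (simp add: y_def)
  have u: "u N = z" "\<And>i. i < N \<Longrightarrow> u i = y * s i" by (auto simp: u_def theta_vars_def s_def)
  have u0: "u i \<noteq> 0" for i using y z s by (simp add: u_def theta_vars_def s_def)
  define V where "V = (\<Prod>j<N. \<Prod>i<j. s j - s i)"
  define V' where "V' = (\<Prod>j<N. \<Prod>i<j. inverse (s j) - inverse (s i))"
  define off where "off = (\<lambda>f::nat \<Rightarrow> nat \<Rightarrow> complex. \<Prod>i<N. \<Prod>j<N. if i \<noteq> j then f i j else 1)"
  have "(\<Prod>i<N. u i) = y ^ N"
    using prod_torus_s[OF N, of \<theta>] by (simp add: u prod.distrib s_def)
  then have "(-1) ^ N * (\<Prod>i<Suc N. u i) = (-1) ^ N * (-1) ^ N"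
    using z by (simp add: u y_def)
  then have t1: "theta r ((-1) ^ (Suc N - 1) * (\<Prod>i<Suc N. u i)) = theta r 1"
    by (simp flip: power_mult_distrib)
  \<comment> \<open>Since y = r x z, the differences with the last variable supply 1 - r s_i x; the
    other differences are y times those of the s_i.\<close>
  have t2: "(\<Prod>j<Suc N. \<Prod>i<j. u j - u i) = (\<Prod>j<N. y ^ j) * V * (z ^ N * (\<Prod>i<N. 1 - r * s i * x))"
  proof -
    have "(\<Prod>j<N. \<Prod>i<j. u j - u i) = (\<Prod>j<N. \<Prod>i<j. y * (s j - s i))"
      by (intro prod.cong refl) (auto simp: u algebra_simps)
    also have "\<dots> = (\<Prod>j<N. y ^ j) * V"
      by (simp add: prod.distrib V_def)
    finally have "(\<Prod>j<N. \<Prod>i<j. u j - u i) = (\<Prod>j<N. y ^ j) * V" .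
    moreover have "(\<Prod>i<N. u N - u i) = (\<Prod>i<N. z * (1 - r * s i * x))"
      by (intro prod.cong refl) (auto simp: u y_def algebra_simps)
    ultimately show ?thesis by (simp add: prod.distrib)
  qed
  \<comment> \<open>The ratios u_i / u_N = r s_i x give matter products lacking their first factor,
    which \<open>t2\<close> supplies. The reverse ratios satisfy q u_N / u_i = r / (s_i x), as q =
    r^2, and give complete products.\<close>
  have t3: "(\<Prod>i<Suc N. \<Prod>j<Suc N. qpoch (q * (u i / u j)) q) =
     (\<Prod>i<N. \<Prod>j<N. qpoch (q * (s i / s j)) q) * (\<Prod>i<N. qpoch (q * (r * s i * x)) q) * (\<Prod>i<N. qpoch (r * inverse (s i) * inverse x) q) * qpoch q q"
  proof -
    have e1: "q * (u i / u j) = q * (s i / s j)" if "i < N" "j < N" for i j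
      using that y by (simp add: u)
    have e2: "q * (u i / u N) = q * (r * s i * x)" if "i < N" for i
      using that z by (simp add: u y_def)
    have e3: "q * (u N / u i) = r * inverse (s i) * inverse x" if "i < N" for i
      using that z r x s[of i] by (simp add: u y_def q_def field_simps power2_eq_square)
    have e4: "q * (u N / u N) = q" using u0[of N] by simp
    have "(\<Prod>i<N. \<Prod>j<N. qpoch (q * (u i / u j)) q) = (\<Prod>i<N. \<Prod>j<N. qpoch (q * (s i / s j)) q)"
      "(\<Prod>i<N. qpoch (q * (u i / u N)) q) = (\<Prod>i<N. qpoch (q * (r * s i * x)) q)"
      "(\<Prod>i<N. qpoch (q * (u N / u i)) q) = (\<Prod>i<N. qpoch (r * inverse (s i) * inverse x) q)"
      by (intro prod.cong refl arg_cong2[where f = qpoch] e1 e2 e3; simp)+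
    then show ?thesis
      unfolding prod.lessThan_Suc prod.distrib e4 by (simp only: mult_ac)
  qed
  have t4: "(\<Prod>i<N. \<Prod>j<N. qpoch (q * (s i / s j)) q) = qpoch q q ^ N * off (\<lambda>i j. qpoch (q * (s i / s j)) q)"
    unfolding off_def by (subst prod_diagonal) (simp add: s)
  have t5: "(1 - r * s i * x) * qpoch (q * (r * s i * x)) q = qpoch (r * s i * x) q" for i
    using qpoch_rec[OF q, of "r * s i * x"] by (simp add: mult_ac)
  \<comment> \<open>For each pair, (s_j - s_i)(1/s_j - 1/s_i) = (1 - s_i/s_j)(1 - s_j/s_i), the
    first factors of the two off-diagonal products.\<close>
  have t6: "V * V' = off (\<lambda>i j. 1 - s i / s j)"
    unfolding V_def V'_def off_def prod_off_diagonal prod.distrib[symmetric]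
    using s by (intro prod.cong refl) (simp add: field_simps)
  have t7: "off (\<lambda>i j. 1 - s i / s j) * off (\<lambda>i j. qpoch (q * (s i / s j)) q) = off (\<lambda>i j. qpoch (s i / s j) q)"
  proof -
    have "(1 - s i / s j) * qpoch (q * (s i / s j)) q = qpoch (s i / s j) q" for i j
      using qpoch_rec[OF q, of "s i / s j"] by (simp add: mult.commute)
    then show ?thesis
      unfolding off_def prod.distrib[symmetric] by (intro prod.cong refl) auto
  qed
  have "theta_det N r y z \<theta> = theta_kernel r (Suc N) u"
    unfolding theta_det_def u_def[symmetric] using theta_kernel_leibniz[OF r _ u0, of "Suc N"] by simp
  also have "\<dots> = theta r 1 * ((\<Prod>j<N. y ^ j) * V * (z ^ N * (\<Prod>i<N. 1 - r * s i * x))) *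
      (qpoch q q ^ N * off (\<lambda>i j. qpoch (q * (s i / s j)) q) * (\<Prod>i<N. qpoch (q * (r * s i * x)) q) * (\<Prod>i<N. qpoch (r * inverse (s i) * inverse x) q) * qpoch q q)"
    unfolding theta_kernel_def t1 t2 q_def[symmetric] t3 t4 ..
  also have "\<dots> = theta r 1 * z ^ N * (\<Prod>j<N. y ^ j) * qpoch q q ^ Suc N * (V * off (\<lambda>i j. qpoch (q * (s i / s j)) q)
      * ((\<Prod>i<N. (1 - r * s i * x) * qpoch (q * (r * s i * x)) q) * (\<Prod>i<N. qpoch (r * inverse (s i) * inverse x) q)))"
    by (simp add: prod.distrib mult_ac)
  finally have det: "theta_det N r y z \<theta> = theta r 1 * z ^ N * (\<Prod>j<N. y ^ j) * qpoch q q ^ Suc N * (V * off (\<lambda>i j. qpoch (q * (s i / s j)) q)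
      * ((\<Prod>i<N. qpoch (r * s i * x) q) * (\<Prod>i<N. qpoch (r * inverse (s i) * inverse x) q)))"
    unfolding t5 .
  have "su_integrand m N q r x \<theta> = (V * V' * off (\<lambda>i j. qpoch (q * (s i / s j)) q))
     * ((\<Prod>i<N. qpoch (r * s i * x) q) * (\<Prod>i<N. qpoch (r * inverse (s i) * inverse x) q)) * (\<Sum>l<N. s l powi m)"
    unfolding t6 t7 by (simp add: su_integrand_def s_def[symmetric] Let_def off_def prod.distrib)
  then show ?thesis
    unfolding det s_def[symmetric] V'_def[symmetric] by (simp only: mult_ac)
qed

section \<open>Evaluation of the moments\<close>

text \<open>Only pairs with b congruent to k + d mod n contribute, written b = k + d + n c. The
  substitution k = a + t - c anticipates the applications, where it removes the mixed term of the
  quadratic exponent and lets the sums over a and c separate.\<close>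

lemma has_sum_supported_reindex:
  fixes F :: "int \<times> int \<Rightarrow> complex" and d t :: int
  assumes F: "(F has_sum S) (UNIV \<times> UNIV)" and n: "n > 0"
    and zero: "\<And>k b. (b - k - d) mod int n \<noteq> 0 \<Longrightarrow> F (k, b) = 0"
  shows "((\<lambda>(a, c). F (a + t - c, a + t - c + d + int n * c)) has_sum S) (UNIV \<times> UNIV)"
proof -
  define T where "T = {(k, b). (b - k - d) mod int n = 0}"
  have "(F has_sum S) T"
    using F by (rule has_sum_cong_neutral[THEN iffD1, rotated -1]) (auto simp: T_def zero)
  moreover have "bij_betw (\<lambda>(a, c). (a + t - c, a + t - c + d + int n * c)) (UNIV \<times> UNIV) T"
  proof (rule bij_betwI[where g = "\<lambda>(k, b). (k + (b - k - d) div int n - t, (b - k - d) div int n)"])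
    show "(\<lambda>(k, b). (k + (b - k - d) div int n - t, (b - k - d) div int n)) \<in> T \<rightarrow> UNIV \<times> UNIV" by auto
    fix p assume "p \<in> T"
    then obtain k b where p: "p = (k, b)" "(b - k - d) mod int n = 0" by (auto simp: T_def)
    then have "int n * ((b - k - d) div int n) = b - k - d"
      using mult_div_mod_eq[of "int n" "b - k - d"] by simp
    then show "(case (case p of (k, b) \<Rightarrow> (k + (b - k - d) div int n - t, (b - k - d) div int n)) of (a, c) \<Rightarrow> (a + t - c, a + t - c + d + int n * c)) = p"
      by (simp add: p)
  qed (use n in \<open>auto simp: T_def\<close>)
  ultimately have "((\<lambda>p. F (case p of (a, c) \<Rightarrow> (a + t - c, a + t - c + d + int n * c))) has_sum S) (UNIV \<times> UNIV)"
    by (subst has_sum_reindex_bij_betw)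
  then show ?thesis by (simp add: case_prod_unfold)
qed

text \<open>A Gaussian series in r^N. Since an infinite sum defaults to 0 when it does not converge,
  this also shows that the series of the final formulas are genuine.\<close>

lemma summable_quadratic:
  fixes r x :: complex and N :: nat and c :: int
  assumes r: "r \<noteq> 0" "norm r < 1" and x: "x \<noteq> 0" and N: "N > 0"
  shows "(\<lambda>n::int. (-1) powi (int N * n) * r powi (int N * n * n + c * n) * x powi (int N * n)) summable_on UNIV"
proof -
  define w where "w = (-1) ^ N * r powi c * x ^ N"
  have "(-1) powi (int N * n) * r powi (int N * n * n + c * n) * x powi (int N * n) = (r ^ N) powi (n * n) * w powi n" for n
    using r x by (simp add: w_def power_int_mult power_int_add power_int_mult_distrib mult.assoc)
  moreover have "norm (r ^ N) < 1" "r ^ N \<noteq> 0" "w \<noteq> 0"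
    using r x N by (auto simp: w_def norm_power power_less_one_iff)
  ultimately show ?thesis
    using abs_summable_summable[OF summable_on_gauss[of "r ^ N" w]] by simp
qed

lemma has_sum_quadratic_neg:
  fixes r x :: complex and N :: nat and c :: int
  assumes "r \<noteq> 0" "norm r < 1" "x \<noteq> 0" "N > 0"
  shows "((\<lambda>n::int. (-1) powi (int N * n) * r powi (int N * n * n - c * n) * x powi (- (int N * n))) has_sum
     (\<Sum>\<^sub>\<infinity>n::int. (-1) powi (int N * n) * r powi (int N * n * n + c * n) * x powi (int N * n))) UNIV"
proof -
  have sg: "(-1) powi (- (int N * n)) = ((-1) powi (int N * n) :: complex)" for n
    by (simp add: power_int_minus flip: power_int_inverse)
  have "bij (uminus :: int \<Rightarrow> int)" by (rule bij_uminus)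
  from has_sum_reindex_bij_betw[OF this, of "\<lambda>n. (-1) powi (int N * n) * r powi (int N * n * n + c * n) * x powi (int N * n)"]
  show ?thesis
    using has_sum_infsum[OF summable_quadratic[OF assms, of c]] sg by simp
qed

lemma prod_powi_consecutive:
  fixes y :: complex
  assumes "y \<noteq> 0"
  shows "(\<Prod>i<N. y powi (k + int i)) = (y ^ N) powi k * (\<Prod>i<N. y ^ i)"
proof -
  have "(\<Prod>i<N. y powi k) = (y ^ N) powi k"
    using prod_powi[of "\<lambda>_. y" "{..<N}" k] by simp
  then show ?thesis
    using assms by (simp add: power_int_add prod.distrib)
qed

text \<open>The constraint reads z^(N+1) = (-1)^N (r x)^(-N). It trades powers of z with exponent
  divisible by N+1 for powers of r and x.\<close>

lemma powi_of_constraint: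
  fixes r x z :: complex
  assumes "r \<noteq> 0" "x \<noteq> 0" "z \<noteq> 0" and z: "(r * x * z) ^ N * z = (-1) ^ N"
  shows "z powi (int (Suc N) * c) = (-1) powi (int N * c) * r powi (- (int N * c)) * x powi (- (int N * c))"
proof -
  have "z ^ Suc N * (r * x) ^ N = (-1) ^ N"
    using z by (simp add: power_mult_distrib mult_ac)
  then have "z ^ Suc N = (-1) ^ N * inverse (r ^ N) * inverse (x ^ N)"
    using assms by (simp add: power_mult_distrib field_simps)
  then have "(z ^ Suc N) powi c = ((-1) ^ N) powi c * inverse (r ^ N) powi c * inverse (x ^ N) powi c"
    by (simp only: power_int_mult_distrib)
  then show ?thesis
    by (simp only: power_int_mult power_int_minus power_int_inverse power_int_of_nat)
qed

text \<open>The first N exponents k, ..., k+N-1 occupy N residues mod N+1, so the last is b = k + N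
  + (N+1) c. Apart from the prefactor, the exponent of r becomes (k+c)^2 + N c^2. With a = k + c,
  the sum over a is the triple product at argument 1, and the sum over c is the series of the
  statement.\<close>

lemma theta_moment_0:
  assumes r: "r \<noteq> 0" "norm r < 1" and x: "x \<noteq> 0" and N: "N > 0" and z: "z \<noteq> 0" "(r * x * z) ^ N * z = (-1) ^ N"
  defines "y \<equiv> r * x * z" and "q \<equiv> r\<^sup>2"
  shows "theta_moment N r y z (\<lambda>i. - int i) = (\<Prod>j<N. y ^ j) * z ^ N * (qpoch q q * theta r 1) *
     (\<Sum>\<^sub>\<infinity>n::int. (-1) powi (int N * n) * r powi (int N * n * n) * x powi (int N * n))"
  (is "_ = ?B * _ * _ * ?S")
proof -
  define n where "n = Suc N"
  have y: "y \<noteq> 0" using r x z by (simp add: y_def)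
  define F where "F = (\<lambda>(k, b). alt_coeff r n (\<lambda>i. if i < N then k + int i else b) * ((\<Prod>i<N. y powi (k + int i)) * z powi b))"
  have F: "(F has_sum theta_moment N r y z (\<lambda>i. - int i)) (UNIV \<times> UNIV)"
    using theta_moment_expansion(2)[OF N r y z(1), of "\<lambda>i. - int i"] by (simp add: F_def n_def cong: if_cong)
  have zero: "F (k, b) = 0" if "(b - k - int N) mod int n \<noteq> 0" for k b
  proof -
    define t where "t = (b - k) mod int n"
    have t: "0 \<le> t" "t < int n" "(b - k) mod int n = t" by (auto simp: t_def n_def)
    have "t \<noteq> int N"
      using that by (auto simp: t_def mod_diff_left_eq[symmetric, of "b - k"])
    with t have t': "nat t < N" "int (nat t) = t" by (auto simp: n_def)
    have "(k + t) mod int n = b mod int n"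
      unfolding t_def by (metis add.commute diff_add_cancel mod_add_left_eq)
    then have "alt_coeff r n (\<lambda>i. if i < N then k + int i else b) = 0"
      using t' by (intro alt_coeff_eq_0[OF r(1), of "nat t" _ N]) (auto simp: n_def)
    then show ?thesis by (simp add: F_def)
  qed
  have val: "F (a + 0 - c, a + 0 - c + int N + int n * c) =
     ?B * z ^ N * (((-1) powi a * r powi (a * a) * 1 powi a) * ((-1) powi (int N * c) * r powi (int N * c * c - 0 * c) * x powi (- (int N * c))))" for a c
  proof -
    define k where "k = a - c"
    define e where "e = (\<lambda>i::nat. k + int i)"
    have "alt_coeff r n (\<lambda>i. if i < N then k + int i else k + int N + int n * c) = alt_coeff r n (e(N := e N + int n * c))"
      by (rule alt_coeff_cong) (auto simp: e_def n_def)
    also have "\<dots> = ((-1) ^ n) powi k * r powi (k * k) * ((-1) powi c * r powi (int n * c * c + (2 * e N + 1 - int n) * c))"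
      using alt_coeff_shift[OF r(1), of N n e c] alt_coeff_consecutive[OF r(1), of N k] by (simp add: n_def e_def)
    finally have alt: "alt_coeff r n (\<lambda>i. if i < N then k + int i else k + int N + int n * c) =
       ((-1) ^ n) powi k * r powi (k * k) * ((-1) powi c * r powi (int n * c * c + (2 * e N + 1 - int n) * c))" .
    note zn = powi_of_constraint[OF r(1) x z, of c, folded n_def]
    \<comment> \<open>By the constraint y^N z = (-1)^N, so the common exponent k leaves only a
      sign.\<close>
    have yz: "(y ^ N) powi k * z powi k = ((-1) ^ N) powi k"
      using z(2) by (simp add: y_def flip: power_int_mult_distrib)
    have sg: "((-1) ^ n) powi k * ((-1) ^ N) powi k * (-1) powi c = ((-1) powi a :: complex)"
    proof -
      have "(-1) ^ n * (-1) ^ N = (-1 :: complex)"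
        by (simp add: n_def flip: power_mult_distrib)
      then have "((-1) ^ n) powi k * ((-1) ^ N) powi k = ((-1) powi k :: complex)"
        by (simp flip: power_int_mult_distrib)
      then show ?thesis by (simp add: k_def flip: power_int_add)
    qed
    have ex: "r powi (k * k) * r powi (int n * c * c + (2 * e N + 1 - int n) * c) * r powi (- (int N * c)) = r powi (a * a) * r powi (int N * c * c)"
    proof -
      have "k * k + (int n * c * c + (2 * e N + 1 - int n) * c) + - (int N * c) = a * a + int N * c * c"
        by (simp add: k_def e_def n_def algebra_simps)
      then show ?thesis
        using r(1) by (simp only: power_int_add[OF disjI1[OF r(1)], symmetric])
    qed
    have "F (a + 0 - c, a + 0 - c + int N + int n * c) =
       (((-1) ^ n) powi k * r powi (k * k) * ((-1) powi c * r powi (int n * c * c + (2 * e N + 1 - int n) * c)))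
        * ((y ^ N) powi k * ?B * (z powi k * z ^ N * z powi (int n * c)))"
      unfolding F_def prod.case add_0_right k_def[symmetric] alt prod_powi_consecutive[OF y]
      using z by (simp add: power_int_add)
    also have "\<dots> = ?B * z ^ N * (((-1) ^ n) powi k * ((y ^ N) powi k * z powi k) * (-1) powi c)
        * (r powi (k * k) * r powi (int n * c * c + (2 * e N + 1 - int n) * c) * r powi (- (int N * c)))
        * (-1) powi (int N * c) * x powi (- (int N * c))"
      unfolding zn by (simp only: mult_ac)
    also have "\<dots> = ?B * z ^ N * (((-1) powi a * r powi (a * a) * 1 powi a) * ((-1) powi (int N * c) * r powi (int N * c * c - 0 * c) * x powi (- (int N * c))))"
      unfolding yz sg ex by (simp add: mult_ac)
    finally show ?thesis .
  qed
  define g where "g = (\<lambda>a::int. (-1) powi a * r powi (a * a) * 1 powi a)"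
  define h where "h = (\<lambda>c::int. (-1) powi (int N * c) * r powi (int N * c * c - 0 * c) * x powi (- (int N * c)))"
  have "((\<lambda>(a, c). F (a + 0 - c, a + 0 - c + int N + int n * c)) has_sum theta_moment N r y z (\<lambda>i. - int i)) (UNIV \<times> UNIV)"
    by (rule has_sum_supported_reindex[OF F _ zero]) (simp add: n_def)
  then have "((\<lambda>(a, c). ?B * z ^ N * (g a * h c)) has_sum theta_moment N r y z (\<lambda>i. - int i)) (UNIV \<times> UNIV)"
    unfolding val by (simp only: g_def h_def)
  moreover have "((\<lambda>(a, c). g a * h c) has_sum (qpoch q q * theta r 1 * ?S)) (UNIV \<times> UNIV)"
  proof (rule has_sum_product_complex)
    show "(g has_sum (qpoch q q * theta r 1)) UNIV"
      unfolding g_def q_def by (rule jacobi_triple[OF r]) simp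
    show "(h has_sum ?S) UNIV"
      unfolding h_def using has_sum_quadratic_neg[OF r x N, of 0] by simp
  qed
  from has_sum_cmult_right[OF this, of "?B * z ^ N"]
  have "((\<lambda>(a, c). ?B * z ^ N * (g a * h c)) has_sum (?B * z ^ N * (qpoch q q * theta r 1 * ?S))) (UNIV \<times> UNIV)"
    by (simp only: case_prod_unfold)
  ultimately have "theta_moment N r y z (\<lambda>i. - int i) = ?B * z ^ N * (qpoch q q * theta r 1 * ?S)"
    by (rule has_sum_unique)
  then show ?thesis by (simp only: mult.assoc)
qed

text \<open>Inserting s_l lowers the exponent k + l to k + l - 1, which variable l - 1 already
  has.\<close>

lemma theta_moment_1_zero:
  assumes r: "r \<noteq> 0" "norm r < 1" and y: "y \<noteq> 0" and z: "z \<noteq> 0" and l: "0 < l" "l < N"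
  shows "theta_moment N r y z (\<lambda>i. - int i + (if i = l then 1 else 0)) = 0"
proof -
  have "alt_coeff r (Suc N) (\<lambda>i. if i < N then k - (- int i + (if i = l then 1 else 0)) else b) = 0" for k b
    by (rule alt_coeff_eq_0[OF r(1), of l _ "l - 1"]) (use l in auto)
  then have "((\<lambda>_. 0) has_sum theta_moment N r y z (\<lambda>i. - int i + (if i = l then 1 else 0))) (UNIV \<times> UNIV :: (int \<times> int) set)"
    using theta_moment_expansion(2)[OF _ r y z, of N "\<lambda>i. - int i + (if i = l then 1 else 0)"] l
    by (simp add: case_prod_unfold)
  then show ?thesis
    by (rule has_sum_unique[OF _ has_sum_0_simp])
qed

text \<open>With s_0 inserted the first exponents are k-1, k+1, ..., k+N-1. As k-1 is congruent to
  k+N, the free residue is that of k, so b = k + (N+1) c. Apart from the prefactor, the exponent of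
  r becomes (k-1+c)^2 + N c^2 - 2(N-1)c, which dictates k = a + 1 - c.\<close>

lemma theta_moment_1:
  assumes r: "r \<noteq> 0" "norm r < 1" and x: "x \<noteq> 0" and N: "N > 0" and z: "z \<noteq> 0" "(r * x * z) ^ N * z = (-1) ^ N"
  defines "y \<equiv> r * x * z" and "q \<equiv> r\<^sup>2"
  shows "theta_moment N r y z (\<lambda>i. - int i + (if i = 0 then 1 else 0)) = - (\<Prod>j<N. y ^ j) * inverse y * (qpoch q q * theta r 1) *
     (\<Sum>\<^sub>\<infinity>n::int. (-1) powi (int N * n) * r powi (int N * n * n + 2 * (int N - 1) * n) * x powi (int N * n))"
  (is "theta_moment N r y z ?e = - ?B * _ * _ * ?S")
proof -
  define n where "n = Suc N"
  have y: "y \<noteq> 0" using r x z by (simp add: y_def)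
  define F where "F = (\<lambda>(k, b). alt_coeff r n (\<lambda>i. if i < N then k - ?e i else b) * ((\<Prod>i<N. y powi (k - ?e i)) * z powi b))"
  have F: "(F has_sum theta_moment N r y z ?e) (UNIV \<times> UNIV)"
    using theta_moment_expansion(2)[OF N r y z(1), of ?e] unfolding F_def n_def .
  have zero: "F (k, b) = 0" if "(b - k - 0) mod int n \<noteq> 0" for k b
  proof -
    define t where "t = (b - k) mod int n"
    have "0 \<le> t" "t < int n" "t \<noteq> 0"
      using that by (auto simp: t_def n_def)
    then have t: "0 < t" "t < int n" by simp_all
    have bt: "(k + t) mod int n = b mod int n"
      unfolding t_def by (metis add.commute diff_add_cancel mod_add_left_eq)
    have "alt_coeff r n (\<lambda>i. if i < N then k - ?e i else b) = 0"
    \<comment> \<open>Relative to k, the residue N is taken by variable 0 with exponent k - 1, and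
      any other nonzero residue t by variable t.\<close>
    proof (cases "t = int N")
      case True
      then have "k - 1 + int n = k + t" by (simp add: n_def)
      then have "(k - 1) mod int n = b mod int n"
        using bt by (metis mod_add_self2)
      then show ?thesis
        using N by (intro alt_coeff_eq_0[OF r(1), of 0 _ N]) (auto simp: n_def)
    next
      case False
      with t have "0 < nat t" "nat t < N" "int (nat t) = t" by (auto simp: n_def)
      then show ?thesis
        using bt by (intro alt_coeff_eq_0[OF r(1), of "nat t" _ N]) (auto simp: n_def)
    qed
    then show ?thesis by (simp add: F_def)
  qed
  define g where "g = (\<lambda>a::int. (-1) powi a * r powi (a * a) * 1 powi a)"
  define h where "h = (\<lambda>c::int. (-1) powi (int N * c) * r powi (int N * c * c - 2 * (int N - 1) * c) * x powi (- (int N * c)))"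
  have val: "F (a + 1 - c, a + 1 - c + 0 + int n * c) = - ?B * inverse y * (g a * h c)" for a c
  proof -
    define k where "k = a + 1 - c"
    \<comment> \<open>The exponents arise from the consecutive ones k, ..., k+N by exchanging the
      first and the last, lowering the first from k+N to k-1 and raising the last from k by n
      c.\<close>
    define e where "e = (\<lambda>i::nat. k + int i)"
    define e' where "e' = (\<lambda>i. e (Transposition.transpose 0 N i))"
    define e'' where "e'' = e'(0 := e' 0 + int n * (-1))"
    define X where "X = r powi (int n * (-1) * (-1) + (2 * e' 0 + 1 - int n) * (-1))"
    define Y where "Y = r powi (int n * c * c + (2 * e'' N + 1 - int n) * c)"
    have "alt_coeff r n (\<lambda>i. if i < N then k - ?e i else k + 0 + int n * c) = alt_coeff r n (e''(N := e'' N + int n * c))"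
      using N by (intro alt_coeff_cong) (auto simp: e''_def e'_def e_def n_def Transposition.transpose_def)
    also have "\<dots> = alt_coeff r n e'' * ((-1) powi c * Y)"
      unfolding Y_def by (rule alt_coeff_shift) (use r in \<open>auto simp: n_def\<close>)
    also have "alt_coeff r n e'' = alt_coeff r n e' * ((-1) powi (-1) * X)"
      unfolding X_def e''_def by (rule alt_coeff_shift) (use r in \<open>auto simp: n_def\<close>)
    also have "alt_coeff r n e' = - alt_coeff r n e"
      using N alt_coeff_permute[of "Transposition.transpose 0 N" n r e]
      by (simp add: e'_def n_def permutes_swap_id sign_swap_id)
    also have "alt_coeff r n e = ((-1) ^ n) powi k * r powi (k * k)"
      unfolding e_def n_def by (rule alt_coeff_consecutive[OF r(1)])
    finally have alt: "alt_coeff r n (\<lambda>i. if i < N then k - ?e i else k + 0 + int n * c) =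
       ((-1) ^ n) powi k * r powi (k * k) * X * ((-1) powi c * Y)"
      by simp
    have prod_y: "(\<Prod>i<N. y powi (k - ?e i)) = (y ^ N) powi k * ?B * inverse y"
    proof -
      have "(\<Prod>i<N. y powi (k - ?e i)) = (\<Prod>i<N. y powi (k + int i) * (if i = 0 then inverse y else 1))"
        using y by (intro prod.cong) (auto simp: power_int_add power_int_diff divide_inverse)
      also have "\<dots> = (\<Prod>i<N. y powi (k + int i)) * inverse y"
        using N by (simp add: prod.distrib)
      finally show ?thesis unfolding prod_powi_consecutive[OF y] .
    qed
    note zn = powi_of_constraint[OF r(1) x z, of c, folded n_def]
    have yz: "(y ^ N) powi k * z powi k = ((-1) ^ N) powi k"
      using z(2) by (simp add: y_def flip: power_int_mult_distrib)
    have sg: "((-1) ^ n) powi k * ((-1) ^ N) powi k * (-1) powi c = (- ((-1) powi a) :: complex)"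
    proof -
      have "(-1) ^ n * (-1) ^ N = (-1 :: complex)"
        by (simp add: n_def flip: power_mult_distrib)
      then have "((-1) ^ n) powi k * ((-1) ^ N) powi k = ((-1) powi k :: complex)"
        by (simp flip: power_int_mult_distrib)
      moreover have "(-1) powi k * (-1) powi c = ((-1) powi (a + 1) :: complex)"
        by (simp add: k_def flip: power_int_add)
      ultimately show ?thesis by (simp add: power_int_add)
    qed
    have ex: "r powi (k * k) * X * Y * r powi (- (int N * c)) = r powi (a * a) * r powi (int N * c * c - 2 * (int N - 1) * c)"
    proof -
      have ee: "e' 0 = k + int N" "e'' N = k"
        using N by (auto simp: e'_def e''_def e_def)
      have "k * k + (int n * (-1) * (-1) + (2 * e' 0 + 1 - int n) * (-1)) + (int n * c * c + (2 * e'' N + 1 - int n) * c) + - (int N * c)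
          = a * a + (int N * c * c - 2 * (int N - 1) * c)"
        unfolding ee by (simp add: k_def n_def algebra_simps)
      then show ?thesis
        unfolding X_def Y_def by (simp only: power_int_add[OF disjI1[OF r(1)], symmetric])
    qed
    have "F (a + 1 - c, a + 1 - c + 0 + int n * c) =
       (((-1) ^ n) powi k * r powi (k * k) * X * ((-1) powi c * Y))
        * (((y ^ N) powi k * ?B * inverse y) * (z powi k * z powi (int n * c)))"
      unfolding F_def prod.case k_def[symmetric] alt prod_y
      using z by (simp add: power_int_add)
    also have "\<dots> = ?B * inverse y * (((-1) ^ n) powi k * ((y ^ N) powi k * z powi k) * (-1) powi c)
        * (r powi (k * k) * X * Y * r powi (- (int N * c)))
        * (-1) powi (int N * c) * x powi (- (int N * c))"
      unfolding zn by (simp only: mult_ac)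
    also have "\<dots> = - ?B * inverse y * (g a * h c)"
      unfolding yz sg ex g_def h_def by (simp add: mult_ac)
    finally show ?thesis .
  qed
  have "((\<lambda>(a, c). F (a + 1 - c, a + 1 - c + 0 + int n * c)) has_sum theta_moment N r y z ?e) (UNIV \<times> UNIV)"
    by (rule has_sum_supported_reindex[OF F _ zero]) (simp_all add: n_def)
  then have "((\<lambda>(a, c). - ?B * inverse y * (g a * h c)) has_sum theta_moment N r y z ?e) (UNIV \<times> UNIV)"
    unfolding val .
  moreover have "((\<lambda>(a, c). g a * h c) has_sum (qpoch q q * theta r 1 * ?S)) (UNIV \<times> UNIV)"
  proof (rule has_sum_product_complex)
    show "(g has_sum (qpoch q q * theta r 1)) UNIV"
      unfolding g_def q_def by (rule jacobi_triple[OF r]) simp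
    show "(h has_sum ?S) UNIV"
      unfolding h_def by (rule has_sum_quadratic_neg[OF r x N])
  qed
  from has_sum_cmult_right[OF this, of "- ?B * inverse y"]
  have "((\<lambda>(a, c). - ?B * inverse y * (g a * h c)) has_sum (- ?B * inverse y * (qpoch q q * theta r 1 * ?S))) (UNIV \<times> UNIV)"
    by (simp only: case_prod_unfold)
  ultimately have "theta_moment N r y z ?e = - ?B * inverse y * (qpoch q q * theta r 1 * ?S)"
    by (rule has_sum_unique)
  then show ?thesis by (simp only: mult.assoc)
qed

text \<open>The N! equal Vandermonde terms cancel the 1/N! of the definition. Of the factor
  (q;q)^(N+1) from the determinant, (q;q)^(N-1) is already part of \<open>Wloop\<close>, leaving a
  square.\<close>

lemma Wloop_eq_theta_moments:
  assumes r: "r \<noteq> 0" "norm r < 1" and x: "x \<noteq> 0" and N: "N > 0" and z: "z \<noteq> 0" "(r * x * z) ^ N * z = (-1) ^ N"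
  defines "q \<equiv> r\<^sup>2" and "y \<equiv> r * x * z"
  shows "theta r 1 * z ^ N * (\<Prod>j<N. y ^ j) * qpoch q q ^ 2 * Wloop m N q r x =
     (\<Sum>l<N. theta_moment N r y z (\<lambda>i. - int i + (if i = l then m else 0)))"
proof -
  define K where "K = theta r 1 * z ^ N * (\<Prod>j<N. y ^ j) * qpoch q q ^ Suc N"
  have y: "y \<noteq> 0" using r x z by (simp add: y_def)
  have "K * (LINT \<theta>|torus_measure N. su_integrand m N q r x \<theta>) = (LINT \<theta>|torus_measure N. K * su_integrand m N q r x \<theta>)"
    by simp
  also have "\<dots> = fact N * (\<Sum>l<N. theta_moment N r y z (\<lambda>i. - int i + (if i = l then m else 0)))"
    unfolding K_def q_def y_def su_integrand_factor[OF r x N z]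
    using integral_theta_det_vandermonde[OF N r _ z(1)] y by (simp add: y_def)
  finally have int: "K * (LINT \<theta>|torus_measure N. su_integrand m N q r x \<theta>) =
    fact N * (\<Sum>l<N. theta_moment N r y z (\<lambda>i. - int i + (if i = l then m else 0)))" .
  have "theta r 1 * z ^ N * (\<Prod>j<N. y ^ j) * qpoch q q ^ 2 * Wloop m N q r x =
     K * (LINT \<theta>|torus_measure N. su_integrand m N q r x \<theta>) / fact N"
  proof -
    have "qpoch q q ^ Suc N = qpoch q q ^ 2 * qpoch q q ^ (N - 1)"
      using N by (simp flip: power_add)
    then show ?thesis
      unfolding Wloop_def K_def by simp
  qed
  then show ?thesis unfolding int by simp
qed

theorem theorem1p6:
  fixes N :: nat and q r x :: complex
  assumes "N \<ge> 2" and "norm q < 1" and "q \<noteq> 0" and "r ^ 2 = q" and "x \<noteq> 0"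
  shows "IIN N q r x =
           (1 / qpoch q q) *
           (\<Sum>\<^sub>\<infinity>n::int. (-1) powi (int N * n) * r powi (int N * n * n) * x powi (int N * n)) \<and>
         Wloop 1 N q r x =
           (- x * r) ^ (N - 1) / qpoch q q *
           (\<Sum>\<^sub>\<infinity>n::int. (-1) powi (int N * n)
               * r powi (int N * n * n + 2 * (int N - 1) * n) * x powi (int N * n))"
proof -
  note x = \<open>x \<noteq> 0\<close>
  have N: "N > 0" using assms(1) by simp
  have q: "q = r\<^sup>2" by (rule assms(4)[symmetric])
  have "r \<noteq> 0" using assms(3) by (auto simp: q)
  moreover have "norm r < 1"
    using assms(2) unfolding q norm_power by (simp add: power_less_one_iff)
  ultimately have r: "r \<noteq> 0" "norm r < 1" .
  define S0 where "S0 = (\<Sum>\<^sub>\<infinity>n::int. (-1) powi (int N * n) * r powi (int N * n * n) * x powi (int N * n))"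
  define S1 where "S1 = (\<Sum>\<^sub>\<infinity>n::int. (-1) powi (int N * n) * r powi (int N * n * n + 2 * (int N - 1) * n) * x powi (int N * n))"
  \<comment> \<open>One solution of z^(N+1) = (-1)^N (r x)^(-N). The branch of the logarithm is
    immaterial, since every power of z cancels in the end.\<close>
  define z where "z = exp (Ln ((-1) ^ N / (r * x) ^ N) / of_nat (Suc N))"
  have "z ^ Suc N = (-1) ^ N / (r * x) ^ N"
    unfolding z_def exp_of_nat_mult[symmetric] using r x by (simp del: of_nat_Suc)
  moreover have "(r * x * z) ^ N * z = (r * x) ^ N * z ^ Suc N"
    by (simp add: power_mult_distrib mult_ac)
  ultimately have zz: "(r * x * z) ^ N * z = (-1) ^ N"
    using r x by simp
  have z: "z \<noteq> 0" using zz N by auto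
  define y where "y = r * x * z"
  have y: "y \<noteq> 0" using r x z by (simp add: y_def)
  define B where "B = (\<Prod>j<N. y ^ j)"
  define Q where "Q = qpoch q q"
  define T where "T = theta r 1"
  have B: "B \<noteq> 0" using y by (simp add: B_def)
  have Q: "Q \<noteq> 0" unfolding Q_def by (rule qpoch_nonzero[OF assms(2,2)])
  have T: "T \<noteq> 0"
    unfolding T_def theta_def assms(4) using r assms(2) by (simp add: qpoch_nonzero)
  note W = Wloop_eq_theta_moments[OF r x N z zz, folded q y_def, folded T_def B_def Q_def]
  \<comment> \<open>For m = 0 all N insertions give the same moment; \<open>IIN\<close> divides by
    this factor N.\<close>
  have "T * z ^ N * B * Q\<^sup>2 * Wloop 0 N q r x = of_nat N * (B * z ^ N * (Q * T) * S0)"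
    unfolding W using theta_moment_0[OF r x N z zz, folded q y_def, folded T_def B_def Q_def S0_def]
    by simp
  then have "(T * z ^ N * B * Q) * (Q * Wloop 0 N q r x) = (T * z ^ N * B * Q) * (of_nat N * S0)"
    by (simp only: mult_ac power2_eq_square)
  then have "Q * Wloop 0 N q r x = of_nat N * S0"
    using T z B Q by simp
  then have "Wloop 0 N q r x = of_nat N * S0 / Q"
    using Q by (metis nonzero_mult_div_cancel_left)
  then have "IIN N q r x = 1 / Q * S0"
    using N by (simp add: IIN_def)
  moreover have "Wloop 1 N q r x = (- x * r) ^ (N - 1) / Q * S1"
  proof -
    have "T * z ^ N * B * Q\<^sup>2 * Wloop 1 N q r x = (\<Sum>l<N. theta_moment N r y z (\<lambda>i. - int i + (if i = l then 1 else 0)))"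
      by (rule W)
    also have "\<dots> = theta_moment N r y z (\<lambda>i. - int i + (if i = 0 then 1 else 0))"
    proof -
      have "(\<Sum>l<N. theta_moment N r y z (\<lambda>i. - int i + (if i = l then 1 else 0))) =
         (\<Sum>l\<in>{0}. theta_moment N r y z (\<lambda>i. - int i + (if i = l then 1 else 0)))"
        using theta_moment_1_zero[OF r y z, of _ N] N by (intro sum.mono_neutral_right) auto
      then show ?thesis by simp
    qed
    also have "\<dots> = - B * inverse y * (Q * T) * S1"
      using theta_moment_1[OF r x N z zz, folded q y_def, folded T_def B_def Q_def S1_def] .
    finally have "(T * B * Q) * (z ^ N * (Q * Wloop 1 N q r x)) = (T * B * Q) * (- inverse y * S1)"
      by (simp only: mult_ac power2_eq_square mult_minus_left mult_minus_right)
    then have zW: "z ^ N * (Q * Wloop 1 N q r x) = - inverse y * S1"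
      using T B Q by (metis mult_cancel_left mult_eq_0_iff)
    \<comment> \<open>Origin of the prefactor in the second formula: multiplied by y, the right side
      is (-1)^(N-1) (-1)^N = -1 by the constraint.\<close>
    have yz: "- inverse y = (- x * r) ^ (N - 1) * z ^ N"
    proof -
      obtain M where M: "N = Suc M" using N by (cases N) auto
      have "(- x * r) ^ M * z ^ N * y = (-1) ^ M * ((r * x * z) ^ N * z)"
        unfolding y_def M power_mult_distrib power_minus[of x] by (simp add: mult_ac)
      also have "\<dots> = (-1) ^ M * (-1) ^ N"
        unfolding zz ..
      also have "\<dots> = -1"
        unfolding M by (simp flip: power_mult_distrib)
      finally have "(- x * r) ^ M * z ^ N * y * inverse y = - inverse y" by simp
      then show ?thesis using y by (simp add: M mult.assoc)
    qed
    have "z ^ N * (Q * Wloop 1 N q r x) = z ^ N * ((- x * r) ^ (N - 1) * S1)"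
      unfolding zW yz by (simp only: mult_ac)
    then have "Q * Wloop 1 N q r x = (- x * r) ^ (N - 1) * S1"
      using z by (metis mult_cancel_left power_not_zero)
    then show ?thesis
      using Q by (metis nonzero_mult_div_cancel_left times_divide_eq_left)
  qed
  ultimately show ?thesis
    by (simp only: S0_def S1_def Q_def)
qed

end
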